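(* Let $\mathbb T=\mathbb R/\mathbb Z$ with Lebesgue measure $|\cdot|$. (1) For all $0<q\le p<2$, for every $0$-symmetric open set $E\subset\mathbb T$ with $|E|>0$ and every $\varepsilon>0$, there exists a positive definite trigonometric polynomial $f$ such that $$\int_{\mathbb T\setminus E}|f|^p\le \varepsilon\left(\int_{\mathbb T}|f|^q\right)^{p/q}.$$ (2) For every $p>0$ which is not an even integer, there exists $q(p)<p$ such that for every $q$ with $q(p)<q<p$, for every $0$-symmetric open set $E\subset\mathbb T$ with $|E|>0$ and every $\varepsilon>0$, there exists a positive definite trigonometric polynomial $f$ such that $$\int_{\mathbb T\setminus E}|f|^p\le \varepsilon\left(\int_{\mathbb T}|f|^q\right)^{p/q}.$$
   Context: $e_k(x)=e^{2\pi i kx}$. A positive definite trigonometric polynomial is a finite sum $\sum_{k\in H}a_k e_k$ with $H\subset\mathbb Z$ finite and all $a_k\ge 0$. A set $E\subset\mathbb T$ is $0$-symmetric if $E=-E$. *)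

theory Defs
  imports "HOL-Analysis.Analysis"
begin

text \<open>The torus T = R/Z is modelled by 1-periodic objects on the real line;
  integration over T is integration over the fundamental domain [0,1].\<close>

definition e :: "int \<Rightarrow> real \<Rightarrow> complex" where
  "e k x = exp (2 * complex_of_real pi * \<i> * of_int k * complex_of_real x)"

definition pos_def_trig_poly :: "(real \<Rightarrow> complex) \<Rightarrow> bool" where
  "pos_def_trig_poly f \<longleftrightarrow>
     (\<exists>H (a :: int \<Rightarrow> real). finite H \<and> (\<forall>k\<in>H. a k \<ge> 0) \<and>
        f = (\<lambda>x. \<Sum>k\<in>H. complex_of_real (a k) * e k x))"

text \<open>A subset of T, represented as a 1-periodic subset of R.\<close>
definition torus_set :: "real set \<Rightarrow> bool" where
  "torus_set E \<longleftrightarrow> (\<forall>x. x \<in> E \<longleftrightarrow> x + 1 \<in> E)"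

definition zero_symmetric :: "real set \<Rightarrow> bool" where
  "zero_symmetric E \<longleftrightarrow> (\<forall>x. x \<in> E \<longleftrightarrow> - x \<in> E)"

definition torus_measure :: "real set \<Rightarrow> ennreal" where
  "torus_measure E = emeasure lborel (E \<inter> {0..<1})"

definition torus_int :: "real set \<Rightarrow> (real \<Rightarrow> complex) \<Rightarrow> real \<Rightarrow> real" where
  "torus_int S f p = (LINT x:(S \<inter> {0..1})|lborel. norm (f x) powr p)"

end

theory Submission
  imports Defs
begin

text \<open>
  The engine is the failure of the Hardy--Littlewood majorant property: there are trigonometric
  polynomials $h$, $H$ with real coefficients, $|\hat h| \le \hat H$, and yet
  $\|H\|_p < \|h\|_q$. For $q \le p < 2$ take $h$ of Rudin--Shapiro type with lacunary frequencies, so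
  that $\|h\|_q$ is of order $2^{n/2}$ while $\|H\|_p$ is close to $\|1 + e_1\|_p^n$ and
  $\|1 + e_1\|_p < 2^{1/2}$. For $p$ not an even integer take $1 + r e_1 \mp t e_m$ with
  $m = \lfloor p/2 \rfloor + 2$ (Boas): for small $r$ the derivative of $\|1 + r e_1 + t e_m\|_p^p$ at
  $t = 0$ has the sign of the binomial coefficient of $p/2$ over $m$, which is negative; then move $q$
  slightly below $p$ by continuity.

  Multiplying independent dilates $h(L_1 x) \cdots h(L_n x)$ makes the ratio exponentially large in $n$.
  Fix $y \in E$, let $\kappa(x) = \cos^2 \pi x$ and put
  $f = 2 \kappa^N H_n + (\kappa(\cdot - y)^N + \kappa(\cdot + y)^N) h_n$ with $N$ proportional to $n$.
  The coefficients of the second summand are real and dominated by those of the first, so $f$ is positive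
  definite. Off $E$ the second summand is exponentially small, whereas near $y$ it loses only a factor
  $\theta^N$ with $\theta$ as close to $1$ as desired, which the exponential gain absorbs.
\<close>

subsection \<open>Positive definite trigonometric polynomials and majorants\<close>

lemma e_eq_cis: "e k x = cis (2 * pi * of_int k * x)"
  by (simp add: e_def cis_conv_exp mult_ac)

lemma norm_e [simp]: "norm (e k x) = 1"
  by (simp add: e_eq_cis)

lemma e_zero [simp]: "e 0 x = 1"
  by (simp add: e_def)

lemma e_mult: "e j x * e k x = e (j + k) x"
  by (simp add: e_eq_cis cis_mult algebra_simps)

lemma e_add_arg: "e k (x + y) = e k x * e k y"
  by (simp add: e_eq_cis cis_mult algebra_simps)

lemma e_power: "e k x ^ n = e (int n * k) x"
  by (induction n) (simp_all add: e_mult algebra_simps)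

lemma cnj_e: "cnj (e k x) = e (- k) x"
  by (simp add: e_eq_cis cis_cnj)

lemma e_dilate: "e k (real L * x) = e (k * int L) x"
  by (simp add: e_eq_cis algebra_simps)

lemma e_periodic: "e k (x + 1) = e k x"
proof -
  have "cis (2 * pi * of_int k) = 1"
    by (rule cis_multiple_2pi) simp
  then show ?thesis
    unfolding e_add_arg by (simp add: e_eq_cis)
qed

lemma continuous_on_e [continuous_intros]: "continuous_on S (e k)"
  unfolding e_def[abs_def] by (intro continuous_intros)

lemma has_integral_e: "((\<lambda>x. e k x) has_integral (if k = 0 then 1 else 0)) {0..1}"
proof (cases "k = 0")
  case True
  then show ?thesis using has_integral_const_real[of "1::complex" 0 1] by simp
next
  case False
  define c where "c = 2 * complex_of_real pi * \<i> * of_int k"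
  have c: "c \<noteq> 0" using False by (simp add: c_def)
  have "((\<lambda>x. exp (c * complex_of_real x) / c) has_vector_derivative exp (c * complex_of_real x)) (at x within {0..1})" for x
    using c by (auto intro!: derivative_eq_intros has_vector_derivative_real_field)
  then have "((\<lambda>x. exp (c * complex_of_real x)) has_integral
      exp (c * complex_of_real 1) / c - exp (c * complex_of_real 0) / c) {0..1}"
    by (intro fundamental_theorem_of_calculus) auto
  moreover have "exp (c * complex_of_real 1) = 1"
    using e_periodic[of k 0] by (simp add: e_def c_def)
  ultimately show ?thesis using False
    by (simp add: e_def[abs_def] c_def)
qed

section \<open>Closure properties of the cone of positive definite polynomials\<close>

lemma pos_def_trig_poly_zero: "pos_def_trig_poly (\<lambda>x. 0)"
  unfolding pos_def_trig_poly_def by (rule exI[of _ "{}"]) auto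

lemma pos_def_trig_poly_monomial:
  "c \<ge> 0 \<Longrightarrow> pos_def_trig_poly (\<lambda>x. complex_of_real c * e k x)"
  unfolding pos_def_trig_poly_def by (rule exI[of _ "{k}"], rule exI[of _ "\<lambda>_. c"]) auto

lemma pos_def_trig_poly_add:
  assumes "pos_def_trig_poly f" "pos_def_trig_poly g"
  shows "pos_def_trig_poly (\<lambda>x. f x + g x)"
proof -
  obtain H a where f: "finite H" "\<And>k. k \<in> H \<Longrightarrow> a k \<ge> 0"
      "f = (\<lambda>x. \<Sum>k\<in>H. complex_of_real (a k) * e k x)"
    using assms(1) unfolding pos_def_trig_poly_def by blast
  obtain K b where g: "finite K" "\<And>k. k \<in> K \<Longrightarrow> b k \<ge> 0"
      "g = (\<lambda>x. \<Sum>k\<in>K. complex_of_real (b k) * e k x)"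
    using assms(2) unfolding pos_def_trig_poly_def by blast
  \<comment> \<open>\<open>a\<close> and \<open>b\<close> are arbitrary outside \<open>H\<close> and
    \<open>K\<close>, so both are cut to zero there before being added.\<close>
  define c where "c = (\<lambda>k. (if k \<in> H then a k else 0) + (if k \<in> K then b k else 0))"
  have "f x + g x = (\<Sum>k\<in>H \<union> K. complex_of_real (c k) * e k x)" for x
  proof -
    have "f x = (\<Sum>k\<in>H \<union> K. complex_of_real (if k \<in> H then a k else 0) * e k x)"
      unfolding f(3) by (rule sum.mono_neutral_cong_left) (use f(1) g(1) in auto)
    moreover have "g x = (\<Sum>k\<in>H \<union> K. complex_of_real (if k \<in> K then b k else 0) * e k x)"
      unfolding g(3) by (rule sum.mono_neutral_cong_left) (use f(1) g(1) in auto)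
    ultimately show ?thesis
      by (simp add: c_def algebra_simps sum.distrib)
  qed
  moreover have "c k \<ge> 0" for k
    using f(2) g(2) by (auto simp: c_def)
  ultimately show ?thesis
    unfolding pos_def_trig_poly_def using f(1) g(1)
    by (intro exI[of _ "H \<union> K"] exI[of _ c]) auto
qed

lemma pos_def_trig_poly_sum:
  assumes "finite I" "\<And>i. i \<in> I \<Longrightarrow> pos_def_trig_poly (f i)"
  shows "pos_def_trig_poly (\<lambda>x. \<Sum>i\<in>I. f i x)"
  using assms
  by (induction I rule: finite_induct) (simp_all add: pos_def_trig_poly_zero pos_def_trig_poly_add)

lemma pos_def_trig_poly_mult:
  assumes "pos_def_trig_poly f" "pos_def_trig_poly g"
  shows "pos_def_trig_poly (\<lambda>x. f x * g x)"
proof -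
  obtain H a where f: "finite H" "\<And>k. k \<in> H \<Longrightarrow> a k \<ge> 0"
      "f = (\<lambda>x. \<Sum>k\<in>H. complex_of_real (a k) * e k x)"
    using assms(1) unfolding pos_def_trig_poly_def by blast
  obtain K b where g: "finite K" "\<And>k. k \<in> K \<Longrightarrow> b k \<ge> 0"
      "g = (\<lambda>x. \<Sum>k\<in>K. complex_of_real (b k) * e k x)"
    using assms(2) unfolding pos_def_trig_poly_def by blast
  \<comment> \<open>Equal frequencies \<open>j + k\<close> need not be collected: a finite sum of
    nonnegative monomials is already known to be positive definite.\<close>
  have "(\<lambda>x. f x * g x) = (\<lambda>x. \<Sum>j\<in>H. \<Sum>k\<in>K. complex_of_real (a j * b k) * e (j + k) x)"
    unfolding f(3) g(3) by (simp add: sum_product e_mult[symmetric] mult_ac)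
  then show ?thesis
    by (simp only:) (intro pos_def_trig_poly_sum pos_def_trig_poly_monomial f g mult_nonneg_nonneg)
qed

lemma pos_def_trig_poly_const: "c \<ge> 0 \<Longrightarrow> pos_def_trig_poly (\<lambda>x. complex_of_real c)"
  using pos_def_trig_poly_monomial[of c 0] by simp

lemma pos_def_trig_poly_cmult:
  "c \<ge> 0 \<Longrightarrow> pos_def_trig_poly f \<Longrightarrow> pos_def_trig_poly (\<lambda>x. complex_of_real c * f x)"
  by (intro pos_def_trig_poly_mult pos_def_trig_poly_const)

lemma pos_def_trig_poly_power:
  "pos_def_trig_poly f \<Longrightarrow> pos_def_trig_poly (\<lambda>x. f x ^ n)"
  by (induction n) (use pos_def_trig_poly_const[of 1] in \<open>auto intro: pos_def_trig_poly_mult\<close>)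

lemma pos_def_trig_poly_dilate:
  assumes "pos_def_trig_poly f"
  shows "pos_def_trig_poly (\<lambda>x. f (real L * x))"
proof -
  obtain H a where f: "finite H" "\<And>k. k \<in> H \<Longrightarrow> a k \<ge> 0"
      "f = (\<lambda>x. \<Sum>k\<in>H. complex_of_real (a k) * e k x)"
    using assms(1) unfolding pos_def_trig_poly_def by blast
  show ?thesis
    unfolding f(3) e_dilate by (intro pos_def_trig_poly_sum pos_def_trig_poly_monomial f)
qed

lemma pos_def_trig_poly_continuous: "pos_def_trig_poly f \<Longrightarrow> continuous_on S f"
  unfolding pos_def_trig_poly_def by (auto intro!: continuous_intros)

lemma pos_def_trig_poly_periodic: "pos_def_trig_poly f \<Longrightarrow> f (x + 1) = f x"
  unfolding pos_def_trig_poly_def by (auto simp: e_periodic)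

text \<open>
  This says that the coefficients of $h$ are real and bounded in modulus by those of $H$; in this form
  closure under products is an algebraic identity.
\<close>

definition majorant_pair :: "(real \<Rightarrow> complex) \<Rightarrow> (real \<Rightarrow> complex) \<Rightarrow> bool" where
  "majorant_pair h H \<longleftrightarrow>
     pos_def_trig_poly (\<lambda>x. H x + h x) \<and> pos_def_trig_poly (\<lambda>x. H x - h x)"

lemma majorant_pair_refl: "pos_def_trig_poly f \<Longrightarrow> majorant_pair f f"
  unfolding majorant_pair_def
  using pos_def_trig_poly_add[of f f] pos_def_trig_poly_zero by simp

lemma majorant_pair_uminus: "majorant_pair h H \<Longrightarrow> majorant_pair (\<lambda>x. - h x) H"
  unfolding majorant_pair_def by simp

lemma majorant_pair_add:
  assumes "majorant_pair h H" "majorant_pair g G"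
  shows "majorant_pair (\<lambda>x. h x + g x) (\<lambda>x. H x + G x)"
proof -
  have "pos_def_trig_poly (\<lambda>x. (H x + h x) + (G x + g x))"
    "pos_def_trig_poly (\<lambda>x. (H x - h x) + (G x - g x))"
    using assms unfolding majorant_pair_def
    by (auto intro: pos_def_trig_poly_add[of "\<lambda>x. H x + h x"] pos_def_trig_poly_add[of "\<lambda>x. H x - h x"])
  then show ?thesis unfolding majorant_pair_def by (simp add: algebra_simps)
qed

text \<open>Rests on the identities 2(HG + hg) = (H + h)(G + g) + (H - h)(G - g) and 2(HG - hg) = (H
  + h)(G - g) + (H - h)(G + g), whose right sides are positive definite.\<close>

lemma majorant_pair_mult:
  assumes "majorant_pair h H" "majorant_pair g G"
  shows "majorant_pair (\<lambda>x. h x * g x) (\<lambda>x. H x * G x)"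
proof -
  have "pos_def_trig_poly (\<lambda>x. complex_of_real (1/2) * ((H x + h x) * (G x + g x) + (H x - h x) * (G x - g x)))"
    "pos_def_trig_poly (\<lambda>x. complex_of_real (1/2) * ((H x + h x) * (G x - g x) + (H x - h x) * (G x + g x)))"
    using assms unfolding majorant_pair_def
    by (auto intro!: pos_def_trig_poly_cmult
        pos_def_trig_poly_add[OF pos_def_trig_poly_mult pos_def_trig_poly_mult] simp del: of_real_divide)
  then show ?thesis unfolding majorant_pair_def by (simp add: algebra_simps)
qed

lemma majorant_pair_dilate:
  "majorant_pair h H \<Longrightarrow> majorant_pair (\<lambda>x. h (real L * x)) (\<lambda>x. H (real L * x))"
  unfolding majorant_pair_def
  using pos_def_trig_poly_dilate[of "\<lambda>x. H x + h x" L] pos_def_trig_poly_dilate[of "\<lambda>x. H x - h x" L]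
  by blast

text \<open>Recovers both members from the two positive definite combinations, through which
  continuity is inherited.\<close>

lemma majorant_pair_halves:
  "h = (\<lambda>x. ((H x + h x) - (H x - h x)) / (2::complex))"
  "H = (\<lambda>x. ((H x + h x) + (H x - h x)) / (2::complex))"
  by auto

lemma majorant_pair_continuous:
  assumes "majorant_pair h H"
  shows "continuous_on S h" "continuous_on S H"
proof -
  have c: "continuous_on S (\<lambda>x. H x + h x)" "continuous_on S (\<lambda>x. H x - h x)"
    using assms unfolding majorant_pair_def by (auto intro: pos_def_trig_poly_continuous)
  show "continuous_on S h"
    by (subst majorant_pair_halves(1)[of h H]) (intro continuous_intros c, simp)
  show "continuous_on S H"
    by (subst majorant_pair_halves(2)[of H h]) (intro continuous_intros c, simp)
qed

lemma majorant_pair_periodic: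
  assumes "majorant_pair h H"
  shows "h (x + 1) = h x" "H (x + 1) = H x"
proof -
  have c: "H (x + 1) + h (x + 1) = H x + h x" "H (x + 1) - h (x + 1) = H x - h x"
    using assms unfolding majorant_pair_def
    by (auto dest: pos_def_trig_poly_periodic[of _ x])
  have "2 * h (x + 1) = 2 * h x" "2 * H (x + 1) = 2 * H x"
    using c by algebra+
  then show "h (x + 1) = h x" "H (x + 1) = H x" by auto
qed

text \<open>Adding the translates by \<open>y\<close> and \<open>- y\<close> multiplies the k-th
  coefficient by 2 cos(2 pi k y), which is real and lies in [-2, 2]. A single translate would give
  complex factors; this is why the construction is symmetric about 0.\<close>

lemma majorant_pair_symmetric_translates:
  assumes "pos_def_trig_poly f"
  shows "majorant_pair (\<lambda>x. f (x - y) + f (x + y)) (\<lambda>x. 2 * f x)"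
proof -
  obtain H a where f: "finite H" "\<And>k. k \<in> H \<Longrightarrow> a k \<ge> 0"
      "f = (\<lambda>x. \<Sum>k\<in>H. complex_of_real (a k) * e k x)"
    using assms(1) unfolding pos_def_trig_poly_def by blast
  have tr: "e k (x - y) + e k (x + y) = complex_of_real (2 * cos (2 * pi * of_int k * y)) * e k x" for k x
    by (simp add: e_eq_cis complex_eq_iff algebra_simps cos_add cos_diff sin_add sin_diff)
  have ff: "f (x - y) + f (x + y) = (\<Sum>k\<in>H. complex_of_real (a k * (2 * cos (2 * pi * of_int k * y))) * e k x)" for x
    unfolding f(3) sum.distrib[symmetric] distrib_left[symmetric] tr
    by (simp add: mult.assoc)
  have "2 * f x + (f (x - y) + f (x + y)) = (\<Sum>k\<in>H. complex_of_real (a k * (2 + 2 * cos (2 * pi * of_int k * y))) * e k x)" for x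
    unfolding ff unfolding f(3) sum_distrib_left sum.distrib[symmetric]
    by (intro sum.cong) (simp_all add: algebra_simps)
  moreover have "2 * f x - (f (x - y) + f (x + y)) = (\<Sum>k\<in>H. complex_of_real (a k * (2 - 2 * cos (2 * pi * of_int k * y))) * e k x)" for x
    unfolding ff unfolding f(3) sum_distrib_left sum_subtractf[symmetric]
    by (intro sum.cong) (simp_all add: algebra_simps)
  ultimately show ?thesis
    unfolding majorant_pair_def
    using f cos_ge_minus_one cos_le_one
    by (auto intro!: pos_def_trig_poly_sum pos_def_trig_poly_monomial mult_nonneg_nonneg
        simp del: of_real_mult of_real_add of_real_diff simp: add_nonneg_nonneg)
      (smt (verit) cos_ge_minus_one)
qed

subsection \<open>Asymptotic independence of dilates\<close>

lemma periodic_of_int: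
  fixes f :: "real \<Rightarrow> 'a"
  assumes "\<And>x. f (x + 1) = f x"
  shows "f (x + of_int k) = f x"
proof (induction k rule: int_induct[where k = 0])
  case (step1 i)
  then show ?case using assms[of "x + of_int i"] by (simp add: add.assoc)
next
  case (step2 i)
  then show ?case using assms[of "x + of_int (i - 1)"] by (simp add: add.assoc)
qed simp

lemma periodic_continuous_bounded:
  fixes f :: "real \<Rightarrow> 'a::real_normed_vector"
  assumes "continuous_on {0..1} f" "\<And>x. f (x + 1) = f x"
  obtains B where "B > 0" "\<And>x. norm (f x) \<le> B"
proof -
  have "bounded (f ` {0..1})"
    using assms(1) by (intro compact_imp_bounded compact_continuous_image) auto
  then obtain B where B: "B > 0" "\<forall>x\<in>{0..1}. norm (f x) \<le> B"
    by (auto simp: bounded_pos)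
  have "norm (f x) \<le> B" for x
  proof -
    have "f x = f (frac x)"
      using periodic_of_int[of f "frac x" "\<lfloor>x\<rfloor>", OF assms(2)] by (simp add: frac_def)
    moreover have "frac x \<in> {0..1}"
      using frac_ge_0[of x] frac_lt_1[of x] by auto
    ultimately show ?thesis using B(2) by auto
  qed
  with B(1) show ?thesis by (rule that)
qed

text \<open>W(x + 1) - W(x) has derivative 0, hence is constant, and at x = 0 it equals the mean of
  \<open>w\<close>, which vanishes. So \<open>W\<close> is periodic and therefore bounded.\<close>

lemma antiderivative_mean_zero_bounded:
  fixes w :: "real \<Rightarrow> real"
  assumes cont: "continuous_on UNIV w" and per: "\<And>x. w (x + 1) = w x"
    and mean: "integral {0..1} w = 0"
  obtains W B where "\<And>x. (W has_real_derivative w x) (at x)" "\<And>x. \<bar>W x\<bar> \<le> B"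
proof -
  have "\<exists>W. \<forall>x::real. -\<infinity> < ereal x \<longrightarrow> ereal x < \<infinity> \<longrightarrow> (W has_vector_derivative w x) (at x)"
    using cont by (intro einterval_antiderivative) (auto simp: continuous_on_eq_continuous_at)
  then obtain W where W: "\<And>x. (W has_real_derivative w x) (at x)"
    by (auto simp: has_real_derivative_iff_has_vector_derivative)
  have "(w has_integral (W 1 - W 0)) {0..1}"
    using W by (intro fundamental_theorem_of_calculus)
      (auto simp: has_real_derivative_iff_has_vector_derivative[symmetric] intro: has_field_derivative_at_within)
  then have W01: "W 1 = W 0"
    using mean by (simp add: integral_unique)
  have "((\<lambda>x. W (x + 1) - W x) has_real_derivative 0) (at x)" for x
    by (auto intro!: derivative_eq_intros DERIV_chain2[OF W] W simp: per)
  then obtain c where c: "\<And>x. W (x + 1) - W x = c"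
    using DERIV_isconst_all[of "\<lambda>x. W (x + 1) - W x"] by metis
  have Wper: "W (x + 1) = W x" for x
    using c[of 0] c[of x] W01 by simp
  have "continuous_on {0..1} W"
    using W by (meson DERIV_isCont continuous_at_imp_continuous_on)
  then obtain B where "\<And>x. norm (W x) \<le> B"
    using periodic_continuous_bounded[of W] Wper by blast
  with W show ?thesis by (auto intro: that)
qed

text \<open>Integration by parts moves the derivative onto the smooth factor \<open>g\<close>. The
  antiderivative W(Lx)/L of the oscillating factor is O(1/L), and so is the integral.\<close>

lemma integral_polynomial_dilate_tendsto_zero:
  fixes w g :: "real \<Rightarrow> real"
  assumes cont: "continuous_on UNIV w" and per: "\<And>x. w (x + 1) = w x"
    and mean: "integral {0..1} w = 0" and ab: "a \<le> b" and g: "real_polynomial_function g"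
  shows "(\<lambda>L. integral {a..b} (\<lambda>x. g x * w (real L * x))) \<longlonglongrightarrow> 0"
proof -
  obtain W B where W: "\<And>x. (W has_real_derivative w x) (at x)" and B: "\<And>x. \<bar>W x\<bar> \<le> B"
    using antiderivative_mean_zero_bounded[OF cont per mean] by blast
  obtain g' where g': "real_polynomial_function g'" "\<And>x. (g has_real_derivative g' x) (at x)"
    using has_real_derivative_polynomial_function[OF g] by blast
  have contg: "continuous_on S g" "continuous_on S g'" for S
    using g g'(1) by (auto simp: real_polynomial_function_eq[symmetric] intro: continuous_on_polymonial_function)
  have contW: "continuous_on S W" for S
    using W by (meson DERIV_isCont continuous_at_imp_continuous_on)
  obtain M where M: "\<And>x. x \<in> {a..b} \<Longrightarrow> \<bar>g' x\<bar> \<le> M"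
    using compact_imp_bounded[OF compact_continuous_image[OF contg(2)[of "{a..b}"]]]
    unfolding bounded_iff by fastforce
  define C where "C = \<bar>g b\<bar> * B + \<bar>g a\<bar> * B + M * B * (b - a)"
  have B0: "B \<ge> 0" using B[of 0] by simp
  have M0: "M \<ge> 0" using M[of a] ab by auto
  have bound: "\<bar>integral {a..b} (\<lambda>x. g x * w (real L * x))\<bar> \<le> C / real L" if L: "L > 0" for L
  proof -
    define I where "I = integral {a..b} (\<lambda>x. W (real L * x) / real L * g' x)"
    have cI: "continuous_on {a..b} (\<lambda>x. W (real L * x) / real L * g' x)"
      by (intro continuous_intros contg continuous_on_compose2[OF contW[of UNIV]]) (use L in auto)
    have "((\<lambda>x. w (real L * x) * g x) has_integral
        (W (real L * b) / real L * g b - W (real L * a) / real L * g a - I)) {a..b}"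
    proof (rule integration_by_parts[OF bounded_bilinear_mult ab, where f = "\<lambda>x. W (real L * x) / real L"])
      show "continuous_on {a..b} (\<lambda>x. W (real L * x) / real L)"
        by (intro continuous_intros continuous_on_compose2[OF contW[of UNIV]]) (use L in auto)
      show "((\<lambda>x. W (real L * x) / real L) has_vector_derivative w (real L * x)) (at x)" for x
        using L by (auto simp: has_real_derivative_iff_has_vector_derivative[symmetric]
            intro!: derivative_eq_intros DERIV_chain2[OF W])
      have "((\<lambda>x. W (real L * x) / real L * g' x) has_integral I) {a..b}"
        unfolding I_def using cI by (intro integrable_integral integrable_continuous_interval)
      then show "((\<lambda>x. W (real L * x) / real L * g' x) has_integral
         W (real L * b) / real L * g b - W (real L * a) / real L * g a -
         (W (real L * b) / real L * g b - W (real L * a) / real L * g a - I)) {a..b}"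
        by simp
    qed (use contg g'(2) in \<open>auto simp: has_real_derivative_iff_has_vector_derivative[symmetric]\<close>)
    then have "integral {a..b} (\<lambda>x. w (real L * x) * g x) =
        W (real L * b) / real L * g b - W (real L * a) / real L * g a - I"
      by (rule integral_unique)
    then have eq: "integral {a..b} (\<lambda>x. g x * w (real L * x)) =
        g b * (W (real L * b) / real L) - g a * (W (real L * a) / real L) - I"
      by (simp add: mult.commute)
    have "norm I \<le> M * B / real L * (b - a)"
      unfolding I_def
    proof (rule integral_bound[OF ab cI])
      fix x assume "x \<in> {a..b}"
      then have "\<bar>g' x\<bar> * \<bar>W (real L * x)\<bar> \<le> M * B"
        by (intro mult_mono M B M0) auto
      then show "norm (W (real L * x) / real L * g' x) \<le> M * B / real L"
        using L by (simp add: abs_mult divide_right_mono mult.commute)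
    qed
    moreover have "\<bar>g y * (W (real L * y) / real L)\<bar> \<le> \<bar>g y\<bar> * B / real L" for y
      using L B[of "real L * y"] by (simp add: abs_mult divide_right_mono mult_left_mono)
    note this[of a] this[of b]
    ultimately have "\<bar>integral {a..b} (\<lambda>x. g x * w (real L * x))\<bar>
        \<le> \<bar>g b\<bar> * B / real L + \<bar>g a\<bar> * B / real L + M * B / real L * (b - a)"
      unfolding eq real_norm_def by linarith
    also have "\<dots> = C / real L"
      by (simp add: C_def add_divide_distrib)
    finally show ?thesis .
  qed
  have "(\<lambda>L. C / real L) \<longlonglongrightarrow> 0"
    by (rule lim_const_over_n)
  moreover have "\<forall>\<^sub>F L in sequentially. norm (integral {a..b} (\<lambda>x. g x * w (real L * x))) \<le> C / real L"
    using eventually_gt_at_top[of "0::nat"] by eventually_elim (use bound in simp)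
  ultimately show ?thesis
    by (rule Lim_null_comparison[rotated])
qed

text \<open>Fejer's lemma: subtract from \<open>v\<close> its mean, approximate \<open>u\<close>
  uniformly by polynomials, and apply the polynomial case. In the sequel it makes integrals of
  products with dilates factor in the limit.\<close>

lemma integral_mult_dilate_tendsto:
  fixes u v :: "real \<Rightarrow> real"
  assumes u: "continuous_on {a..b} u" and v: "continuous_on UNIV v"
    and per: "\<And>x. v (x + 1) = v x" and ab: "a \<le> b"
  shows "(\<lambda>L. integral {a..b} (\<lambda>x. u x * v (real L * x))) \<longlonglongrightarrow> integral {a..b} u * integral {0..1} v"
proof -
  define c where "c = integral {0..1} v"
  define w where "w = (\<lambda>x. v x - c)"
  have w: "continuous_on S w" for S
    unfolding w_def by (intro continuous_intros continuous_on_subset[OF v]) auto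
  have wper: "w (x + 1) = w x" for x
    by (simp add: w_def per)
  have "v integrable_on {0..1}"
    by (intro integrable_continuous_interval continuous_on_subset[OF v]) auto
  then have mean: "integral {0..1} w = 0"
    unfolding w_def by (subst integral_diff) (auto simp: c_def)
  obtain B where Bpos: "B > 0" and "\<And>x. norm (w x) \<le> B"
    using periodic_continuous_bounded[of w] w wper by blast
  then have B: "\<bar>w x\<bar> \<le> B" for x by simp
  have cw: "continuous_on S (\<lambda>x. w (real L * x))" for L S
    by (rule continuous_on_compose2[OF w[of UNIV]]) (auto intro!: continuous_intros)
  have lim: "(\<lambda>L. integral {a..b} (\<lambda>x. u x * w (real L * x))) \<longlonglongrightarrow> 0"
  proof (rule LIMSEQ_I)
    fix r :: real assume r: "r > 0"
    \<comment> \<open>The summand 1 keeps \<open>D\<close> positive when a = b; \<open>d\<close>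
      then limits the approximation error to r/2.\<close>
    define D where "D = B * (b - a + 1)"
    have D: "D > 0" using Bpos ab by (simp add: D_def)
    define d where "d = r / (2 * D)"
    have d: "d > 0" using r D by (simp add: d_def)
    obtain g where g: "real_polynomial_function g" "\<And>x. x \<in> {a..b} \<Longrightarrow> \<bar>u x - g x\<bar> < d"
      using Stone_Weierstrass_real_polynomial_function[OF compact_Icc u d] by blast
    have cg: "continuous_on {a..b} g"
      using g(1) by (auto simp: real_polynomial_function_eq[symmetric] intro: continuous_on_polymonial_function)
    obtain N where N: "\<And>L. L \<ge> N \<Longrightarrow> norm (integral {a..b} (\<lambda>x. g x * w (real L * x)) - 0) < r / 2"
      using LIMSEQ_D[OF integral_polynomial_dilate_tendsto_zero[OF w wper mean ab g(1)], of "r / 2"] r by auto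
    have "norm (integral {a..b} (\<lambda>x. u x * w (real L * x)) - 0) < r" if "L \<ge> N" for L
    proof -
      have "integral {a..b} (\<lambda>x. u x * w (real L * x)) =
          integral {a..b} (\<lambda>x. (u x - g x) * w (real L * x) + g x * w (real L * x))"
        by (simp add: algebra_simps)
      also have "\<dots> = integral {a..b} (\<lambda>x. (u x - g x) * w (real L * x)) + integral {a..b} (\<lambda>x. g x * w (real L * x))"
        by (intro integral_add integrable_continuous_interval continuous_intros u cg cw)
      finally have eq: "integral {a..b} (\<lambda>x. u x * w (real L * x)) =
          integral {a..b} (\<lambda>x. (u x - g x) * w (real L * x)) + integral {a..b} (\<lambda>x. g x * w (real L * x))" .
      have "norm (integral {a..b} (\<lambda>x. (u x - g x) * w (real L * x))) \<le> d * B * (b - a)"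
      proof (rule integral_bound[OF ab])
        show "continuous_on {a..b} (\<lambda>x. (u x - g x) * w (real L * x))"
          by (intro continuous_intros u cg cw)
        show "norm ((u x - g x) * w (real L * x)) \<le> d * B" if "x \<in> {a..b}" for x
          unfolding real_norm_def abs_mult using g(2)[OF that] B d by (intro mult_mono) auto
      qed
      also have "\<dots> \<le> d * B * (b - a + 1)"
        using d Bpos by (intro mult_left_mono) auto
      also have "\<dots> = r / 2"
        using D by (simp add: d_def mult.assoc flip: D_def)
      finally show ?thesis
        using N[OF that] unfolding eq by (simp only: real_norm_def diff_zero)
    qed
    then show "\<exists>N. \<forall>L\<ge>N. norm (integral {a..b} (\<lambda>x. u x * w (real L * x)) - 0) < r" by blast
  qed
  have "integral {a..b} (\<lambda>x. u x * v (real L * x)) =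
      integral {a..b} (\<lambda>x. u x * w (real L * x)) + integral {a..b} u * c" for L
  proof -
    have "integral {a..b} (\<lambda>x. u x * v (real L * x)) = integral {a..b} (\<lambda>x. u x * w (real L * x) + u x * c)"
      by (simp add: w_def algebra_simps)
    also have "\<dots> = integral {a..b} (\<lambda>x. u x * w (real L * x)) + integral {a..b} (\<lambda>x. u x * c)"
      by (intro integral_add integrable_continuous_interval continuous_intros u cw)
    finally show ?thesis by simp
  qed
  then show ?thesis
    using tendsto_add[OF lim tendsto_const[of "integral {a..b} u * c"]] by (simp add: c_def)
qed

subsection \<open>Failure of the majorant property for exponents that are not even\<close>

text \<open>Factor w^(m+1) out of the tail of the binomial series; the remaining series is bounded
  uniformly on the disc of radius 1/2.\<close>

lemma binomial_series_remainder:
  fixes a :: complex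
  obtains K where "K \<ge> 0"
    "\<And>w. norm w \<le> 1/2 \<Longrightarrow> norm ((1 + w) powr a - (\<Sum>n\<le>m. (a gchoose n) * w ^ n)) \<le> K * norm w ^ Suc m"
proof -
  define c where "c = (\<lambda>n. (a gchoose (n + Suc m)))"
  have S: "(\<lambda>n. (a gchoose n) * w ^ n) sums (1 + w) powr a" if "norm w < 1" for w
    using that by (rule gen_binomial_complex)
  \<comment> \<open>Convergence at 3/4, beyond the radius 1/2, upgrades to absolute convergence at
    1/2.\<close>
  have "summable (\<lambda>n. (a gchoose n) * (3/4) ^ n)"
    using S[of "3/4"] by (simp add: sums_iff)
  then have "summable (\<lambda>n. (a gchoose (n + Suc m)) * (3/4) ^ (n + Suc m))"
    by (rule summable_ignore_initial_segment)
  then have "summable (\<lambda>n. c n * (3/4) ^ n * (3/4) ^ Suc m)"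
    by (simp only: c_def power_add mult.assoc)
  then have "summable (\<lambda>n. c n * (3/4) ^ n)"
    using summable_mult2[of _ "inverse ((3/4) ^ Suc m)"] by (fastforce simp: mult.assoc simp del: power_Suc)
  then have sc: "summable (\<lambda>n. norm (c n * (1/2) ^ n))"
    by (rule powser_insidea) simp
  define K where "K = (\<Sum>n. norm (c n * (1/2) ^ n))"
  show ?thesis
  proof (rule that)
    show "K \<ge> 0" unfolding K_def using sc by (intro suminf_nonneg) auto
    fix w :: complex assume w: "norm w \<le> 1/2"
    then have w1: "norm w < 1" by simp
    have "(\<lambda>n. (a gchoose (n + Suc m)) * w ^ (n + Suc m)) sums
        ((1 + w) powr a - (\<Sum>n<Suc m. (a gchoose n) * w ^ n))"
      using S[OF w1] by (rule sums_split_initial_segment)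
    then have s1: "(\<lambda>n. c n * w ^ n * w ^ Suc m) sums ((1 + w) powr a - (\<Sum>n\<le>m. (a gchoose n) * w ^ n))"
      by (simp only: c_def power_add mult.assoc lessThan_Suc_atMost)
    have le: "norm (c n * w ^ n * w ^ Suc m) \<le> norm (c n * (1/2) ^ n) * norm w ^ Suc m" for n
      unfolding norm_mult norm_power using w by (intro mult_right_mono mult_left_mono power_mono) auto
    have "norm (\<Sum>n. c n * w ^ n * w ^ Suc m) \<le> (\<Sum>n. norm (c n * (1/2) ^ n) * norm w ^ Suc m)"
      by (rule norm_suminf_le[OF le summable_mult2[OF sc]])
    also have "\<dots> = K * norm w ^ Suc m"
      unfolding K_def by (rule suminf_mult2[OF sc, symmetric])
    finally show "norm ((1 + w) powr a - (\<Sum>n\<le>m. (a gchoose n) * w ^ n)) \<le> K * norm w ^ Suc m"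
      using s1 by (simp add: sums_iff)
  qed
qed

text \<open>With k the integer part of s, the numerator s(s-1)...(s-k-1) has exactly one negative
  factor, the last.\<close>

lemma gbinomial_negative:
  fixes s :: real
  assumes "s > 0" "\<And>n::nat. s \<noteq> real n"
  shows "(s gchoose (nat \<lfloor>s\<rfloor> + 2)) < 0"
proof -
  define k where "k = nat \<lfloor>s\<rfloor>"
  have k: "real k \<le> s" "s < real k + 1" "s \<noteq> real k"
    using assms(1) assms(2)[of "nat \<lfloor>s\<rfloor>"] by (auto simp: k_def)
  have pos: "(\<Prod>i<k + 1. s - real i) > 0"
    using k by (intro prod_pos) auto
  have "(\<Prod>i = 0..<k + 2. s - real i) = (\<Prod>i<k + 1. s - real i) * (s - real (k + 1))"
    by (simp add: atLeast0LessThan)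
  also have "\<dots> < 0"
    using pos k by (intro mult_pos_neg) auto
  finally show ?thesis
    unfolding gbinomial_prod_rev k_def[symmetric] by (simp add: divide_neg_pos del: fact_Suc)
qed

text \<open>The frequencies that occur are n - j - m with n \<le> m and j \<ge> 0. Such a frequency
  vanishes only for n = m and j = 0, so orthogonality leaves a single term.\<close>

lemma has_integral_trig_product:
  "((\<lambda>x. (\<Sum>n\<le>m. complex_of_real (b n) * (complex_of_real r * e 1 x) ^ n)
      * cnj (\<Sum>n\<le>m. complex_of_real (c n) * (complex_of_real r * e 1 x) ^ n) * cnj (e (int m) x))
    has_integral complex_of_real (b m * c 0 * r ^ m)) {0..1}"
proof -
  let ?I = "\<lambda>n j. complex_of_real (b n * c j * r ^ (n + j)) * (if int n - int j - int m = 0 then 1 else 0)"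
  have "((\<lambda>x. \<Sum>n\<le>m. \<Sum>j\<le>m. complex_of_real (b n * c j * r ^ (n + j)) * e (int n - int j - int m) x)
      has_integral (\<Sum>n\<le>m. \<Sum>j\<le>m. ?I n j)) {0..1}"
    by (intro has_integral_sum finite_atMost has_integral_mult_right has_integral_e)
  moreover have "(\<Sum>n\<le>m. \<Sum>j\<le>m. ?I n j) = complex_of_real (b m * c 0 * r ^ m)"
  proof -
    have "(\<Sum>n\<le>m. \<Sum>j\<le>m. ?I n j) = (\<Sum>n\<le>m. \<Sum>j\<le>m. if n = m \<and> j = 0 then complex_of_real (b m * c 0 * r ^ m) else 0)"
      by (intro sum.cong refl) auto
    also have "\<dots> = (\<Sum>n\<le>m. if n = m then (\<Sum>j\<le>m. if j = 0 then complex_of_real (b m * c 0 * r ^ m) else 0) else 0)"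
      by (intro sum.cong refl) auto
    also have "\<dots> = complex_of_real (b m * c 0 * r ^ m)"
      by (simp add: sum.delta)
    finally show ?thesis .
  qed
  moreover have "(\<Sum>n\<le>m. complex_of_real (b n) * (complex_of_real r * e 1 x) ^ n)
      * cnj (\<Sum>n\<le>m. complex_of_real (c n) * (complex_of_real r * e 1 x) ^ n) * cnj (e (int m) x) =
      (\<Sum>n\<le>m. \<Sum>j\<le>m. complex_of_real (b n * c j * r ^ (n + j)) * e (int n - int j - int m) x)" for x
  proof -
    have "e (int n - int j - int m) x = e 1 x ^ n * cnj (e 1 x) ^ j * cnj (e (int m) x)" for n j
      by (simp add: cnj_e e_power e_mult)
    then show ?thesis
      unfolding cnj_sum sum_product unfolding sum_distrib_right
      by (intro sum.cong refl) (simp add: power_mult_distrib power_add mult_ac)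
  qed
  ultimately show ?thesis by simp
qed

text \<open>Since (1 + w)^(s-1) times its conjugate is |1 + w|^(2(s-1)), the weight splits into a
  power series in w times the conjugate of another, both open to truncation.\<close>

lemma cmod_one_plus_powr_mult:
  assumes "norm w < 1"
  shows "complex_of_real (((cmod (1 + w))\<^sup>2) powr (s - 1)) * (1 + w) =
    (1 + w) powr complex_of_real s * cnj ((1 + w) powr complex_of_real (s - 1))"
proof -
  have nz: "1 + w \<noteq> 0"
    using assms by (metis add_eq_0_iff norm_minus_cancel norm_one order_less_irrefl)
  have "(1 + w) powr complex_of_real s = (1 + w) powr complex_of_real (s - 1) * (1 + w)"
    using nz powr_add[of "1 + w" "complex_of_real (s - 1)" 1] by simp
  moreover have "(1 + w) powr complex_of_real (s - 1) * cnj ((1 + w) powr complex_of_real (s - 1)) =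
      complex_of_real (((cmod (1 + w))\<^sup>2) powr (s - 1))"
  proof -
    have "(cmod (1 + w) powr (s - 1))\<^sup>2 = ((cmod (1 + w))\<^sup>2) powr (s - 1)"
      by (simp add: power2_eq_square powr_mult)
    then show ?thesis
      by (simp add: complex_norm_square[symmetric] norm_powr_real_powr' del: of_real_power of_real_diff flip: of_real_power)
  qed
  ultimately show ?thesis by (simp add: mult_ac)
qed

text \<open>
  By orthogonality the product of the truncated binomial series contributes only the coefficient
  of $s$ over $m$ times $r^m$; everything else is $O(r^{m+1})$.
\<close>

lemma boas_integral_negative:
  fixes s :: real
  assumes "s > 0" "\<And>n::nat. s \<noteq> real n"
  defines "m \<equiv> nat \<lfloor>s\<rfloor> + 2"
  obtains r where "0 < r" "r \<le> 1/2"
    "integral {0..1} (\<lambda>x. ((cmod (1 + complex_of_real r * e 1 x))\<^sup>2) powr (s - 1) *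
        Re ((1 + complex_of_real r * e 1 x) * cnj (e (int m) x))) < 0"
proof -
  let ?g = "\<lambda>a n. complex_of_real (a gchoose n)"
  have gb: "complex_of_real a gchoose n = ?g a n" for a n
    by (simp add: gbinomial_prod_rev)
  define T where "T = (\<lambda>a w. \<Sum>n\<le>m. ?g a n * w ^ n)"
  obtain K1 where K1: "K1 \<ge> 0" "\<And>w. norm w \<le> 1/2 \<Longrightarrow> norm ((1 + w) powr complex_of_real s - T s w) \<le> K1 * norm w ^ Suc m"
    using binomial_series_remainder[where m = m and a = "complex_of_real s"] unfolding T_def gb by blast
  obtain K2 where K2: "K2 \<ge> 0" "\<And>w. norm w \<le> 1/2 \<Longrightarrow> norm ((1 + w) powr complex_of_real (s - 1) - T (s - 1) w) \<le> K2 * norm w ^ Suc m"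
    using binomial_series_remainder[where m = m and a = "complex_of_real (s - 1)"] unfolding T_def gb by blast
  have contT: "continuous_on S (T a)" for a S
    unfolding T_def by (intro continuous_intros)
  obtain M1 where M1: "M1 > 0" "\<forall>w\<in>cball 0 (1/2). norm (T s w) \<le> M1"
    using compact_imp_bounded[OF compact_continuous_image[OF contT[of "cball 0 (1/2)" s] compact_cball]]
    by (auto simp: bounded_pos)
  obtain M2 where M2: "M2 > 0" "\<forall>w\<in>cball 0 (1/2). norm (T (s - 1) w) \<le> M2"
    using compact_imp_bounded[OF compact_continuous_image[OF contT[of "cball 0 (1/2)" "s - 1"] compact_cball]]
    by (auto simp: bounded_pos)
  \<comment> \<open>Total truncation error: the error \<open>K1\<close> of the first factor times
    the bound \<open>M2 + K2\<close> on the second, plus the bound \<open>M1\<close> on the first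
    polynomial times the error \<open>K2\<close> of the second.\<close>
  define K where "K = K1 * (M2 + K2) + M1 * K2"
  have K0: "K \<ge> 0" using K1(1) K2(1) M1(1) M2(1) by (simp add: K_def)
  define \<beta> where "\<beta> = (s gchoose m)"
  have \<beta>: "\<beta> < 0" unfolding \<beta>_def m_def using gbinomial_negative assms by blast
  \<comment> \<open>Makes K r at most -\<beta>/2, so the error K r^(m+1) cannot cancel the main term
    \<beta> r^m. The summand 1 avoids division by zero.\<close>
  define r where "r = min (1/2) (- \<beta> / (2 * (K + 1)))"
  have r: "0 < r" "r \<le> 1/2" "K * r < - \<beta>"
  proof -
    have "- \<beta> / (2 * (K + 1)) > 0" using \<beta> K0 by (intro divide_pos_pos) auto
    then show "0 < r" "r \<le> 1/2" unfolding r_def by linarith+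
    have "K * r \<le> (K + 1) * (- \<beta> / (2 * (K + 1)))"
      using K0 \<open>0 < r\<close> by (intro mult_mono) (auto simp: r_def)
    also have "\<dots> = - \<beta> / 2" using K0 by (simp add: field_simps)
    finally show "K * r < - \<beta>" using \<beta> by simp
  qed
  define w where "w = (\<lambda>x. complex_of_real r * e 1 x)"
  have nw: "norm (w x) = r" for x using r by (simp add: w_def norm_mult)
  have nw1: "norm (w x) < 1" "norm (w x) \<le> 1/2" "w x \<in> cball 0 (1/2)" for x using nw[of x] r by auto
  define P Q where "P = (\<lambda>x. (1 + w x) powr complex_of_real s)"
    and "Q = (\<lambda>x. (1 + w x) powr complex_of_real (s - 1))"
  define F where "F = (\<lambda>x. P x * cnj (Q x) * cnj (e (int m) x))"
  define G where "G = (\<lambda>x. T s (w x) * cnj (T (s - 1) (w x)) * cnj (e (int m) x))"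
  have w_pos: "0 < 1 + Re (w x)" for x
    using abs_Re_le_cmod[of "w x"] nw1(1)[of x] by simp
  have w_ne: "1 + w x \<noteq> 0" for x
    using w_pos[of x] by (auto simp: complex_eq_iff)
  have contw: "continuous_on S w" for S unfolding w_def by (intro continuous_intros)
  have contF: "continuous_on {0..1} F"
    unfolding F_def P_def Q_def
    by (intro continuous_intros contw) (use w_pos w_ne in \<open>auto simp: less_imp_le\<close>)
  have intG: "(G has_integral complex_of_real (\<beta> * r ^ m)) {0..1}"
    using has_integral_trig_product[where m = m and b = "\<lambda>n. s gchoose n" and r = r and c = "\<lambda>n. (s - 1) gchoose n"]
    by (simp add: G_def T_def w_def \<beta>_def)
  have intF: "(F has_integral integral {0..1} F) {0..1}"
    using contF by (intro integrable_integral integrable_continuous_interval)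
  have diff: "norm (F x - G x) \<le> K * r ^ Suc m" for x
  proof -
    have q: "norm (Q x) \<le> M2 + K2"
    proof -
      have "norm (Q x) \<le> norm (T (s - 1) (w x)) + norm (Q x - T (s - 1) (w x))"
        by norm
      also have "\<dots> \<le> M2 + K2 * norm (w x) ^ Suc m"
        unfolding Q_def using M2(2) K2(2) nw1 by (intro add_mono) auto
      also have "\<dots> \<le> M2 + K2 * 1"
        using K2(1) nw1[of x] by (intro add_left_mono mult_left_mono power_le_one) auto
      finally show ?thesis by simp
    qed
    have "F x - G x = ((P x - T s (w x)) * cnj (Q x) + T s (w x) * cnj (Q x - T (s - 1) (w x))) * cnj (e (int m) x)"
      by (simp add: F_def G_def algebra_simps)
    then have "norm (F x - G x) = norm ((P x - T s (w x)) * cnj (Q x) + T s (w x) * cnj (Q x - T (s - 1) (w x)))"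
      by (simp add: norm_mult)
    also have "\<dots> \<le> norm (P x - T s (w x)) * norm (Q x) + norm (T s (w x)) * norm (Q x - T (s - 1) (w x))"
      by (metis complex_mod_cnj norm_mult norm_triangle_ineq)
    also have "\<dots> \<le> (K1 * r ^ Suc m) * (M2 + K2) + M1 * (K2 * r ^ Suc m)"
    proof (intro add_mono mult_mono q)
      show "norm (P x - T s (w x)) \<le> K1 * r ^ Suc m" using K1(2)[of "w x"] nw1 by (simp add: P_def nw)
      show "norm (Q x - T (s - 1) (w x)) \<le> K2 * r ^ Suc m" using K2(2)[of "w x"] nw1 by (simp add: Q_def nw)
      show "norm (T s (w x)) \<le> M1" using M1(2) nw1 by auto
    qed (use K1 K2 M1 r in auto)
    also have "\<dots> = K * r ^ Suc m" by (simp add: K_def algebra_simps)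
    finally show ?thesis .
  qed
  have FG: "((\<lambda>x. F x - G x) has_integral (integral {0..1} F - complex_of_real (\<beta> * r ^ m))) {0..1}"
    by (intro has_integral_diff intF intG)
  have "norm (integral {0..1} F - complex_of_real (\<beta> * r ^ m)) \<le> K * r ^ Suc m"
    using has_integral_bound_real[of "K * r ^ Suc m" "{}", OF _ _ FG] diff K0 r(1) by simp
  then have "Re (integral {0..1} F) - \<beta> * r ^ m \<le> K * r ^ Suc m"
    using complex_Re_le_cmod[of "integral {0..1} F - complex_of_real (\<beta> * r ^ m)"]
    by (simp add: power_Suc del: of_real_mult)
  moreover have "K * r ^ Suc m + \<beta> * r ^ m < 0"
  proof -
    have "K * r ^ Suc m + \<beta> * r ^ m = (K * r + \<beta>) * r ^ m" by (simp add: algebra_simps)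
    also have "\<dots> < 0" using r by (intro mult_neg_pos) auto
    finally show ?thesis .
  qed
  ultimately have neg: "Re (integral {0..1} F) < 0" by linarith
  have "F x = complex_of_real (((cmod (1 + w x))\<^sup>2) powr (s - 1)) * ((1 + w x) * cnj (e (int m) x))" for x
    unfolding F_def P_def Q_def cmod_one_plus_powr_mult[OF nw1(1), symmetric] by simp
  then have "Re (F x) = ((cmod (1 + w x))\<^sup>2) powr (s - 1) * Re ((1 + w x) * cnj (e (int m) x))" for x
    by (simp only: Re_complex_of_real Im_complex_of_real times_complex.simps)
  moreover have "integral {0..1} (\<lambda>x. Re (F x)) = Re (integral {0..1} F)"
    using has_integral_linear[OF intF bounded_linear_Re] by (intro integral_unique) (simp add: o_def)
  ultimately have "integral {0..1} (\<lambda>x. ((cmod (1 + w x))\<^sup>2) powr (s - 1) * Re ((1 + w x) * cnj (e (int m) x))) < 0"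
    using neg by simp
  then show ?thesis using r that unfolding w_def by blast
qed

section \<open>Perturbation of the p-norm by one extra frequency\<close>

lemma continuous_on_norm_powr [continuous_intros]:
  fixes f :: "real \<Rightarrow> complex"
  assumes "continuous_on S f" "p > 0"
  shows "continuous_on S (\<lambda>x. norm (f x) powr p)"
  using assms by (intro continuous_on_powr' continuous_intros) auto

lemma integral_norm_powr_nonneg: "integral S (\<lambda>x. norm (f x) powr p) \<ge> (0::real)"
  \<comment> \<open>A function that is not integrable has integral 0 by convention.\<close>
  by (cases "(\<lambda>x. norm (f x) powr p) integrable_on S")
    (auto intro: integral_nonneg simp: not_integrable_integral)

lemma square_powr:
  fixes y :: real
  assumes "y \<ge> 0"
  shows "(y\<^sup>2) powr s = y powr (2 * s)"
  using assms by (simp add: power2_eq_square powr_mult flip: powr_add)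

lemma cmod_sq_add_scaled:
  assumes "norm b = 1"
  shows "(cmod (a + complex_of_real t * b))\<^sup>2 = (cmod a)\<^sup>2 + 2 * t * Re (a * cnj b) + t\<^sup>2"
proof -
  have "(Re b)\<^sup>2 + (Im b)\<^sup>2 = 1" using assms by (simp add: cmod_power2[symmetric])
  then have "t\<^sup>2 * ((Re b)\<^sup>2 + (Im b)\<^sup>2) = t\<^sup>2" by simp
  then show ?thesis
    unfolding cmod_power2 by (simp add: power2_eq_square algebra_simps)
qed

text \<open>The function \<open>D\<close> of t, the p-th power integral of a + t e_m, has negative
  derivative at 0. Hence for small t > 0 the polynomial with -t beats its majorant with +t.\<close>

lemma majorant_failure:
  fixes p :: real
  assumes p: "p > 0" and np: "\<And>n::nat. p \<noteq> 2 * real n"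
  obtains h H where "majorant_pair h H"
    "integral {0..1} (\<lambda>x. norm (H x) powr p) < integral {0..1} (\<lambda>x. norm (h x) powr p)"
proof -
  define s where "s = p / 2"
  have s: "s > 0" "s \<noteq> real n" for n using p np[of n] by (auto simp: s_def)
  define m where "m = nat \<lfloor>s\<rfloor> + 2"
  obtain r where r: "0 < r" "r \<le> 1/2"
    and neg: "integral {0..1} (\<lambda>x. ((cmod (1 + complex_of_real r * e 1 x))\<^sup>2) powr (s - 1) *
        Re ((1 + complex_of_real r * e 1 x) * cnj (e (int m) x))) < 0"
    unfolding m_def using boas_integral_negative[OF s] by blast
  define a where "a = (\<lambda>x. 1 + complex_of_real r * e 1 x)"
  define A where "A = (\<lambda>x. (cmod (a x))\<^sup>2)"
  define B where "B = (\<lambda>x. Re (a x * cnj (e (int m) x)))"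
  have sq: "(cmod (a x + complex_of_real t * e (int m) x))\<^sup>2 = A x + 2 * t * B x + t\<^sup>2" for x t
    unfolding A_def B_def by (intro cmod_sq_add_scaled) simp
  have conta: "continuous_on S a" for S unfolding a_def by (intro continuous_intros)
  have contA: "continuous_on S A" and contB: "continuous_on S B" for S
    unfolding A_def B_def by (intro continuous_intros conta)+
  \<comment> \<open>With r \<le> 1/2 this keeps r + |t| below 1, so the base of the power never
    vanishes and the t-derivative is continuous even where the exponent s - 1 is negative.\<close>
  define U where "U = {- 1/8..1/8::real}"
  have pos: "A x + 2 * t * B x + t\<^sup>2 > 0" if "t \<in> U" for x t
  proof -
    have "cmod (complex_of_real r * e 1 x + complex_of_real t * e (int m) x) \<le> r + \<bar>t\<bar>"
      using norm_triangle_ineq[of "complex_of_real r * e 1 x" "complex_of_real t * e (int m) x"] r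
      by (simp add: norm_mult)
    moreover have "r + \<bar>t\<bar> < 1" using r that by (auto simp: U_def)
    ultimately have "cmod (complex_of_real r * e 1 x + complex_of_real t * e (int m) x) \<noteq> cmod (- 1)"
      by simp
    then have "complex_of_real r * e 1 x + complex_of_real t * e (int m) x \<noteq> - 1"
      by metis
    then have "a x + complex_of_real t * e (int m) x \<noteq> 0"
      unfolding a_def by (metis add.assoc add_eq_0_iff)
    then have "(cmod (a x + complex_of_real t * e (int m) x))\<^sup>2 > 0" by simp
    then show ?thesis unfolding sq .
  qed
  then have ne: "A x + 2 * t * B x + t\<^sup>2 \<noteq> 0" if "t \<in> U" for x t
    using that by (metis order_less_irrefl)
  define D where "D = (\<lambda>t. integral {0..1} (\<lambda>x. (A x + 2 * t * B x + t\<^sup>2) powr s))"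
  have D_eq: "D t = integral {0..1} (\<lambda>x. norm (a x + complex_of_real t * e (int m) x) powr p)" for t
    unfolding D_def sq[symmetric] by (simp add: square_powr s_def)
  \<comment> \<open>Differentiation under the integral sign; at t = 0 the result is 2s times the
    integral from \<open>boas_integral_negative\<close>.\<close>
  have "((\<lambda>t. integral (cbox 0 1) (\<lambda>x. (A x + 2 * t * B x + t\<^sup>2) powr s)) has_field_derivative
      integral (cbox 0 1) (\<lambda>x. s * (A x + 2 * 0 * B x + 0\<^sup>2) powr (s - 1) * (2 * B x + 2 * 0))) (at 0 within U)"
  proof (rule leibniz_rule_field_derivative)
    show "((\<lambda>t. (A x + 2 * t * B x + t\<^sup>2) powr s) has_field_derivative
        s * (A x + 2 * t * B x + t\<^sup>2) powr (s - 1) * (2 * B x + 2 * t)) (at t within U)" if "t \<in> U" for t x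
      using pos[OF that] by (auto intro!: derivative_eq_intros)
    show "(\<lambda>x. (A x + 2 * t * B x + t\<^sup>2) powr s) integrable_on cbox 0 1" if "t \<in> U" for t
      using ne[OF that]
      by (intro integrable_continuous continuous_intros contA contB) auto
    show "continuous_on (U \<times> cbox 0 1) (\<lambda>(t, x). s * (A x + 2 * t * B x + t\<^sup>2) powr (s - 1) * (2 * B x + 2 * t))"
      unfolding split_beta
      by (intro continuous_intros continuous_on_compose2[OF contA[of UNIV]] continuous_on_compose2[OF contB[of UNIV]])
        (use ne in auto)
  qed (auto simp: U_def)
  moreover have "(\<lambda>x. s * (A x + 2 * 0 * B x + 0\<^sup>2) powr (s - 1) * (2 * B x + 2 * 0)) = (\<lambda>x. 2 * s * (A x powr (s - 1) * B x))"
    by (auto simp: algebra_simps)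
  ultimately have der: "(D has_real_derivative 2 * s * integral {0..1} (\<lambda>x. A x powr (s - 1) * B x)) (at 0 within U)"
    unfolding D_def by simp
  have neg': "2 * s * integral {0..1} (\<lambda>x. A x powr (s - 1) * B x) < 0"
    using neg s(1) unfolding A_def B_def a_def by (simp add: mult_pos_neg)
  obtain d1 where d1: "d1 > 0" "\<And>h. h > 0 \<Longrightarrow> 0 - h \<in> U \<Longrightarrow> h < d1 \<Longrightarrow> D 0 < D (0 - h)"
    using has_real_derivative_neg_dec_left[OF der neg'] by blast
  obtain d2 where d2: "d2 > 0" "\<And>h. h > 0 \<Longrightarrow> 0 + h \<in> U \<Longrightarrow> h < d2 \<Longrightarrow> D (0 + h) < D 0"
    using has_real_derivative_neg_dec_right[OF der neg'] by blast
  define t where "t = min (1/8) (min (d1/2) (d2/2))"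
  have t: "t > 0" "t < d1" "t < d2" "t \<in> U" "- t \<in> U"
    using d1(1) d2(1) by (auto simp: t_def U_def min_def)
  have D: "D t < D (- t)"
    using d1(2)[of t] d2(2)[of t] t by simp
  have pa: "pos_def_trig_poly a"
    unfolding a_def using pos_def_trig_poly_add[OF pos_def_trig_poly_const[of 1] pos_def_trig_poly_monomial[of r 1]] r
    by simp
  have "majorant_pair (\<lambda>x. a x + complex_of_real (- t) * e (int m) x) (\<lambda>x. a x + complex_of_real t * e (int m) x)"
    using majorant_pair_add[OF majorant_pair_refl[OF pa]
        majorant_pair_uminus[OF majorant_pair_refl[OF pos_def_trig_poly_monomial[of t "int m"]]]] t(1)
    by simp
  then show ?thesis using D unfolding D_eq by (rule that)
qed

text \<open>From |h|^p \<le> B^(p-q) |h|^q, the q-integral of \<open>h\<close> is at least its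
  p-integral times B^(q-p). The power p/q of this lower bound tends to the p-integral as q increases
  to p, so the strict inequality persists.\<close>

lemma majorant_failure_left_neighbourhood:
  fixes p :: real
  assumes p: "p > 0" and hH: "majorant_pair h H"
    and less: "integral {0..1} (\<lambda>x. norm (H x) powr p) < integral {0..1} (\<lambda>x. norm (h x) powr p)"
  obtains q0 where "q0 < p"
    "\<And>q. q0 < q \<Longrightarrow> q < p \<Longrightarrow> 0 < q \<Longrightarrow>
      integral {0..1} (\<lambda>x. norm (H x) powr p) < integral {0..1} (\<lambda>x. norm (h x) powr q) powr (p / q)"
proof -
  let ?I = "\<lambda>q. integral {0..1} (\<lambda>x. norm (h x) powr q)"
  note conth = majorant_pair_continuous(1)[OF hH]
  obtain B where B: "B > 0" "\<And>x. norm (h x) \<le> B"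
    using periodic_continuous_bounded[of h] conth majorant_pair_periodic(1)[OF hH] by metis
  have Ip: "?I p > 0"
    using less integral_norm_powr_nonneg[of "{0..1}" H p] by linarith
  have "((\<lambda>q. (?I p * B powr (q - p)) powr (p / q)) \<longlongrightarrow> (?I p * B powr (p - p)) powr (p / p)) (at_left p)"
    using B Ip p by (intro tendsto_intros) auto
  then have "((\<lambda>q. (?I p * B powr (q - p)) powr (p / q)) \<longlongrightarrow> ?I p) (at_left p)"
    using B Ip p by simp
  from order_tendstoD(1)[OF this less]
  obtain q0 where q0: "q0 < p"
    "\<And>q. q0 < q \<Longrightarrow> q < p \<Longrightarrow> integral {0..1} (\<lambda>x. norm (H x) powr p) < (?I p * B powr (q - p)) powr (p / q)"
    unfolding eventually_at_left_field by blast
  have "?I p * B powr (q - p) \<le> ?I q" if q: "0 < q" "q < p" for q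
  proof -
    have "norm (h x) powr p * B powr (q - p) \<le> norm (h x) powr q" for x
    proof -
      have "norm (h x) powr p = norm (h x) powr q * norm (h x) powr (p - q)"
        by (simp flip: powr_add)
      also have "\<dots> \<le> norm (h x) powr q * B powr (p - q)"
        using B q by (intro mult_left_mono powr_mono2) auto
      finally have "norm (h x) powr p * B powr (q - p) \<le> norm (h x) powr q * B powr (p - q) * B powr (q - p)"
        by (intro mult_right_mono) auto
      also have "\<dots> = norm (h x) powr q"
        using B(1) by (simp add: mult.assoc flip: powr_add)
      finally show ?thesis .
    qed
    then have "integral {0..1} (\<lambda>x. norm (h x) powr p * B powr (q - p)) \<le> ?I q"
      using p q by (intro integral_le integrable_continuous_interval continuous_intros conth) auto
    then show ?thesis by simp
  qed
  then have "(?I p * B powr (q - p)) powr (p / q) \<le> ?I q powr (p / q)" if "0 < q" "q < p" for q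
    using that Ip by (intro powr_mono2) auto
  with q0 show ?thesis
    by (intro that[of q0]) (auto intro: less_le_trans)
qed

subsection \<open>Failure of the majorant property below exponent two\<close>

text \<open>The concave power lies below its tangent at u = 1; here this is convexity of exp between
  ln u and 0.\<close>

lemma powr_le_affine:
  fixes u s :: real
  assumes "u \<ge> 0" "0 < s" "s \<le> 1"
  shows "u powr s \<le> 1 + s * (u - 1)"
proof (cases "u = 0")
  case False
  then have "u powr s = exp (s * ln u + (1 - s) * 0)"
    using assms by (simp add: powr_def)
  also have "\<dots> \<le> s * exp (ln u) + (1 - s) * exp 0"
    using convex_onD[OF exp_convex, of "1 - s" "ln u" 0] assms by (simp add: algebra_simps)
  finally show ?thesis
    using False assms by (simp add: algebra_simps)
qed (use assms in auto)

text \<open>Strict Jensen inequality: |1 + e_1|^2 = 2u with u of mean 1, and the power p/2 < 1 is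
  strictly concave. The gap \<open>g\<close> below the tangent line is continuous, nonnegative and
  not identically zero.\<close>

lemma integral_one_plus_e_powr_less:
  fixes p :: real
  assumes p: "0 < p" "p < 2"
  shows "integral {0..1} (\<lambda>x. norm (1 + e 1 x) powr p) < 2 powr (p / 2)"
proof -
  define s where "s = p / 2"
  have s: "0 < s" "s < 1" using p by (auto simp: s_def)
  define u where "u = (\<lambda>x. 1 + Re (e 1 x))"
  have contu: "continuous_on S u" for S unfolding u_def by (intro continuous_intros)
  have nu: "(norm (1 + e 1 x))\<^sup>2 = 2 * u x" for x
    using cmod_sq_add_scaled[of "e 1 x" 1 1] by (simp add: u_def)
  have u0: "u x \<ge> 0" for x using nu[of x] by (metis zero_le_power2 zero_le_mult_iff zero_less_numeral not_less)
  have np: "norm (1 + e 1 x) powr p = 2 powr s * u x powr s" for x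
    using square_powr[of "norm (1 + e 1 x)" s] u0[of x] unfolding nu by (simp add: s_def powr_mult)
  have "((\<lambda>x. Re (e 1 x)) has_integral 0) {0..1}"
    using has_integral_linear[OF has_integral_e[of 1] bounded_linear_Re] by (simp add: o_def)
  from has_integral_mult_right[OF this, of s]
  have iu: "((\<lambda>x. s * Re (e 1 x)) has_integral 0) {0..1}" by simp
  define g where "g = (\<lambda>x. (1 + s * Re (e 1 x)) - u x powr s)"
  have contup: "continuous_on S (\<lambda>x. u x powr s)" for S
    using u0 s by (intro continuous_on_powr' contu continuous_intros) auto
  have contg: "continuous_on S g" for S
    unfolding g_def by (intro continuous_intros contup)
  have g0: "g x \<ge> 0" for x
    unfolding g_def using powr_le_affine[OF u0[of x] s(1)] s by (simp add: u_def)
  \<comment> \<open>At x = 1/2 one has u = 0, so the gap there is 1 - s > 0.\<close>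
  have eh: "e 1 (1/2) = -1" by (simp add: e_eq_cis)
  have "integral {0..1} g \<noteq> 0"
  proof
    assume "integral {0..1} g = 0"
    then have "(g has_integral 0) (cbox 0 1)"
      using integrable_integral[OF integrable_continuous_interval[OF contg[of "{0..1}"]]] by simp
    then have "g (1/2) = 0"
      by (rule has_integral_0_cbox_imp_0[rotated 2]) (use contg g0 in auto)
    then show False using s by (simp add: g_def u_def eh)
  qed
  moreover have "integral {0..1} g \<ge> 0" using g0 contg by (intro integral_nonneg integrable_continuous_interval) auto
  moreover have "integral {0..1} g = 1 - integral {0..1} (\<lambda>x. u x powr s)"
  proof -
    have i1: "((\<lambda>x. 1 + s * Re (e 1 x)) has_integral (1 + 0)) {0..1}"
      using has_integral_const_real[of "1::real" 0 1] by (intro has_integral_add iu) simp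
    have i2: "((\<lambda>x. u x powr s) has_integral integral {0..1} (\<lambda>x. u x powr s)) {0..1}"
      by (intro integrable_integral integrable_continuous_interval contup)
    show ?thesis
      using integral_unique[OF has_integral_diff[OF i1 i2]] by (simp add: g_def)
  qed
  ultimately have "integral {0..1} (\<lambda>x. u x powr s) < 1" by linarith
  then show ?thesis unfolding np by (simp add: s_def)
qed

text \<open>Rudin-Shapiro recursion (P, Q) to (P + QE, P - QE) with E a character of high frequency.
  The parallelogram law doubles the sum of squares, and the common majorant becomes H(1 + E), whose
  integral nearly factors. The slack between the integral of |1 + e_1|^p and \<open>X\<close>
  absorbs the error.\<close>

lemma rudin_shapiro_lacunary:
  fixes p X :: real
  assumes p: "p > 0" and X: "integral {0..1} (\<lambda>x. norm (1 + e 1 x) powr p) < X"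
  shows "\<exists>P Q H. majorant_pair P H \<and> majorant_pair Q H \<and>
    (\<forall>x. (cmod (P x))\<^sup>2 + (cmod (Q x))\<^sup>2 = 2 ^ Suc n) \<and>
    integral {0..1} (\<lambda>x. norm (H x) powr p) \<le> X ^ n"
proof (induction n)
  case 0
  have "majorant_pair (\<lambda>x. 1) (\<lambda>x. 1)"
    using majorant_pair_refl[OF pos_def_trig_poly_const[of 1]] by simp
  then show ?case by (intro exI[of _ "\<lambda>x. 1"]) auto
next
  case (Suc n)
  then obtain P Q H where PH: "majorant_pair P H" and QH: "majorant_pair Q H"
    and PQ: "\<And>x. (cmod (P x))\<^sup>2 + (cmod (Q x))\<^sup>2 = 2 ^ Suc n"
    and IH: "integral {0..1} (\<lambda>x. norm (H x) powr p) \<le> X ^ n"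
    by blast
  let ?I = "integral {0..1} (\<lambda>x. norm (1 + e 1 x) powr p)"
  have X0: "X > 0" using X integral_norm_powr_nonneg[of "{0..1}" "\<lambda>x. 1 + e 1 x" p] by linarith
  have "(\<lambda>L. integral {0..1} (\<lambda>x. norm (H x) powr p * norm (1 + e 1 (real L * x)) powr p))
      \<longlonglongrightarrow> integral {0..1} (\<lambda>x. norm (H x) powr p) * ?I"
    by (rule integral_mult_dilate_tendsto)
      (use p in \<open>auto intro!: continuous_intros majorant_pair_continuous(2)[OF PH] simp: e_periodic\<close>)
  moreover have "integral {0..1} (\<lambda>x. norm (H x) powr p) * ?I < X ^ Suc n"
  proof -
    have "integral {0..1} (\<lambda>x. norm (H x) powr p) * ?I \<le> X ^ n * ?I"
      by (intro mult_right_mono IH integral_norm_powr_nonneg)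
    also have "\<dots> < X ^ n * X" using X X0 by simp
    finally show ?thesis by (simp add: mult.commute)
  qed
  ultimately have "\<forall>\<^sub>F L in sequentially.
      integral {0..1} (\<lambda>x. norm (H x) powr p * norm (1 + e 1 (real L * x)) powr p) < X ^ Suc n"
    by (rule order_tendstoD(2))
  then obtain L where L: "integral {0..1} (\<lambda>x. norm (H x) powr p * norm (1 + e 1 (real L * x)) powr p) < X ^ Suc n"
    by (meson eventually_happens trivial_limit_sequentially)
  define E where "E = e (int L)"
  have EL: "e 1 (real L * x) = E x" for x by (simp add: e_dilate E_def)
  have EE: "majorant_pair E E"
    using majorant_pair_refl[OF pos_def_trig_poly_monomial[of 1 "int L"]] by (simp add: E_def)
  have QE: "majorant_pair (\<lambda>x. Q x * E x) (\<lambda>x. H x * E x)"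
    by (intro majorant_pair_mult QH EE)
  have "majorant_pair (\<lambda>x. P x + Q x * E x) (\<lambda>x. H x + H x * E x)"
    "majorant_pair (\<lambda>x. P x + - (Q x * E x)) (\<lambda>x. H x + H x * E x)"
    by (intro majorant_pair_add PH QE majorant_pair_uminus)+
  moreover have "(cmod (P x + Q x * E x))\<^sup>2 + (cmod (P x + - (Q x * E x)))\<^sup>2 = 2 ^ Suc (Suc n)" for x
  proof -
    have "(cmod (P x + Q x * E x))\<^sup>2 + (cmod (P x + - (Q x * E x)))\<^sup>2 = 2 * ((cmod (P x))\<^sup>2 + (cmod (Q x * E x))\<^sup>2)"
      unfolding cmod_power2 by (simp add: power2_eq_square algebra_simps)
    also have "\<dots> = 2 ^ Suc (Suc n)"
      using PQ[of x] by (simp add: norm_mult E_def)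
    finally show ?thesis .
  qed
  moreover have "integral {0..1} (\<lambda>x. norm (H x + H x * E x) powr p) \<le> X ^ Suc n"
  proof -
    have "norm (H x + H x * E x) powr p = norm (H x) powr p * norm (1 + E x) powr p" for x
    proof -
      have "H x + H x * E x = H x * (1 + E x)" by (simp add: algebra_simps)
      then show ?thesis by (simp add: norm_mult powr_mult)
    qed
    then show ?thesis using L unfolding EL by simp
  qed
  ultimately show ?case by blast
qed

text \<open>One of P, Q has mean square at least 2^n while its square never exceeds 2^(n+1), so its
  q-norm is at least a constant times 2^(n/2). The majorant's p-integral is at most X^n with X <
  2^(p/2), and a large n separates the two.\<close>

lemma majorant_failure_below_two:
  fixes p q :: real
  assumes pq: "0 < q" "q \<le> p" "p < 2"
  obtains h H where "majorant_pair h H"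
    "integral {0..1} (\<lambda>x. norm (H x) powr p) < integral {0..1} (\<lambda>x. norm (h x) powr q) powr (p / q)"
proof -
  have p: "p > 0" using pq by simp
  obtain X where X: "integral {0..1} (\<lambda>x. norm (1 + e 1 x) powr p) < X" "X < 2 powr (p / 2)"
    using dense[OF integral_one_plus_e_powr_less[OF p pq(3)]] by blast
  have X0: "X > 0" using X integral_norm_powr_nonneg[of "{0..1}" "\<lambda>x. 1 + e 1 x" p] by linarith
  \<comment> \<open>The loss, independent of n, incurred when passing from the mean square to the
    q-norm.\<close>
  define c where "c = 2 powr ((2 - q) * p / (2 * q))"
  have "1 < 2 powr (p / 2) / X" using X X0 by simp
  then obtain n where n: "c < (2 powr (p / 2) / X) ^ n"
    using real_arch_pow by blast
  obtain P Q H where PH: "majorant_pair P H" and QH: "majorant_pair Q H"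
    and PQ: "\<And>x. (cmod (P x))\<^sup>2 + (cmod (Q x))\<^sup>2 = 2 ^ Suc n"
    and IH: "integral {0..1} (\<lambda>x. norm (H x) powr p) \<le> X ^ n"
    using rudin_shapiro_lacunary[OF p X(1), of n] by blast
  have cont2: "continuous_on {0..1} (\<lambda>x. (cmod (P x))\<^sup>2)" "continuous_on {0..1} (\<lambda>x. (cmod (Q x))\<^sup>2)"
    by (intro continuous_intros majorant_pair_continuous(1)[OF PH] majorant_pair_continuous(1)[OF QH])+
  have "integral {0..1} (\<lambda>x. (cmod (P x))\<^sup>2 + (cmod (Q x))\<^sup>2) = 2 ^ Suc n"
    unfolding PQ by simp
  then have "integral {0..1} (\<lambda>x. (cmod (P x))\<^sup>2) + integral {0..1} (\<lambda>x. (cmod (Q x))\<^sup>2) = 2 ^ Suc n"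
    using cont2 by (subst (asm) integral_add) (auto intro: integrable_continuous_interval)
  then have "integral {0..1} (\<lambda>x. (cmod (P x))\<^sup>2) \<ge> 2 ^ n \<or> integral {0..1} (\<lambda>x. (cmod (Q x))\<^sup>2) \<ge> 2 ^ n"
    by (simp, linarith)
  moreover have "(cmod (P x))\<^sup>2 \<le> 2 ^ Suc n" "(cmod (Q x))\<^sup>2 \<le> 2 ^ Suc n" for x
    using PQ[of x] zero_le_power2[of "cmod (P x)"] zero_le_power2[of "cmod (Q x)"] by linarith+
  ultimately obtain h where hH: "majorant_pair h H" and h2: "integral {0..1} (\<lambda>x. (cmod (h x))\<^sup>2) \<ge> 2 ^ n"
    and hle: "\<And>x. (cmod (h x))\<^sup>2 \<le> 2 ^ Suc n"
    using PH QH by blast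
  let ?I = "integral {0..1} (\<lambda>x. norm (h x) powr q)"
  \<comment> \<open>Bounds |h|^(2-q), as |h|^2 \<le> 2^(n+1).\<close>
  define M where "M = 2 powr ((real n + 1) * ((2 - q) / 2))"
  have "(cmod (h x))\<^sup>2 \<le> norm (h x) powr q * M" for x
  proof -
    have "(cmod (h x))\<^sup>2 = norm (h x) powr q * norm (h x) powr (2 - q)"
      by (cases "h x = 0") (simp_all flip: powr_add)
    also have "norm (h x) powr (2 - q) = ((cmod (h x))\<^sup>2) powr ((2 - q) / 2)"
    proof -
      have "2 * ((2 - q) / 2) = 2 - q" by (simp add: field_simps)
      then show ?thesis by (simp only: square_powr norm_ge_zero)
    qed
    also have "norm (h x) powr q * \<dots> \<le> norm (h x) powr q * (2 ^ Suc n) powr ((2 - q) / 2)"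
      using pq hle by (intro mult_left_mono powr_mono2) auto
    also have "(2 ^ Suc n) powr ((2 - q) / 2) = M"
      by (simp add: M_def powr_powr add.commute flip: powr_realpow del: power_Suc)
    finally show ?thesis .
  qed
  then have "integral {0..1} (\<lambda>x. (cmod (h x))\<^sup>2) \<le> integral {0..1} (\<lambda>x. norm (h x) powr q * M)"
    using pq majorant_pair_continuous(1)[OF hH]
    by (intro integral_le integrable_continuous_interval continuous_intros) auto
  then have "2 ^ n \<le> ?I * M" using h2 by simp
  then have "2 ^ n / M \<le> ?I" by (simp add: divide_le_eq M_def)
  then have "(2 ^ n / M) powr (p / q) \<le> ?I powr (p / q)"
    using pq by (intro powr_mono2) (auto simp: M_def)
  moreover have "(2 ^ n / M) powr (p / q) = (2 powr (p / 2)) ^ n / c"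
  proof -
    have "2 ^ n / M = 2 powr (real n - (real n + 1) * ((2 - q) / 2))"
      unfolding M_def by (simp add: powr_diff powr_realpow)
    then have "(2 ^ n / M) powr (p / q) = 2 powr ((real n - (real n + 1) * ((2 - q) / 2)) * (p / q))"
      by (simp add: powr_powr)
    also have "(real n - (real n + 1) * ((2 - q) / 2)) * (p / q) = p / 2 * real n - (2 - q) * p / (2 * q)"
      using pq by (simp add: field_simps)
    also have "2 powr \<dots> = (2 powr (p / 2)) ^ n / c"
      by (simp add: c_def powr_diff powr_powr flip: powr_realpow)
    finally show ?thesis .
  qed
  moreover have "X ^ n < (2 powr (p / 2)) ^ n / c"
    using n X0 by (simp add: c_def power_divide field_simps)
  ultimately have "integral {0..1} (\<lambda>x. norm (H x) powr p) < ?I powr (p / q)"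
    using IH by linarith
  with hH show ?thesis by (rule that)
qed

subsection \<open>Tensor powers\<close>

text \<open>At each step the pair is multiplied by a dilate of (h, H). The gaps around
  \<open>X\<close> and \<open>Y\<close> absorb the error in factoring the integrals. The lower bound
  is kept on a subinterval, for later use near a point of E, and the sup bound controls
  \<open>g\<close> away from it.\<close>

lemma majorant_pair_tensor_power:
  fixes p q X Y a b B :: real
  assumes p: "p > 0" and q: "q > 0" and ab: "a < b" and hH: "majorant_pair h H"
    and B: "\<And>x. norm (h x) \<le> B"
    and X: "integral {0..1} (\<lambda>x. norm (H x) powr p) < X"
    and Y: "0 < Y" "Y < integral {0..1} (\<lambda>x. norm (h x) powr q)"
  shows "\<exists>g G. majorant_pair g G \<and> (\<forall>x. norm (g x) \<le> B ^ n) \<and>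
    integral {0..1} (\<lambda>x. norm (G x) powr p) \<le> X ^ n \<and>
    (b - a) * Y ^ n \<le> integral {a..b} (\<lambda>x. norm (g x) powr q)"
proof (induction n)
  case 0
  have "majorant_pair (\<lambda>x. 1) (\<lambda>x. 1)"
    using majorant_pair_refl[OF pos_def_trig_poly_const[of 1]] by simp
  then show ?case using ab by (intro exI[of _ "\<lambda>x. 1"]) auto
next
  case (Suc n)
  then obtain g G where gG: "majorant_pair g G" and gB: "\<And>x. norm (g x) \<le> B ^ n"
    and IG: "integral {0..1} (\<lambda>x. norm (G x) powr p) \<le> X ^ n"
    and Ig: "(b - a) * Y ^ n \<le> integral {a..b} (\<lambda>x. norm (g x) powr q)"
    by blast
  let ?IH = "integral {0..1} (\<lambda>x. norm (H x) powr p)"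
  let ?Ih = "integral {0..1} (\<lambda>x. norm (h x) powr q)"
  have X0: "X > 0" using X integral_norm_powr_nonneg[of "{0..1}" H p] by linarith
  have B0: "B \<ge> 0" using B[of 0] norm_ge_zero order_trans by blast
  note cont = majorant_pair_continuous[OF hH] majorant_pair_continuous[OF gG]
  have "(\<lambda>L. integral {0..1} (\<lambda>x. norm (G x) powr p * norm (H (real L * x)) powr p))
      \<longlonglongrightarrow> integral {0..1} (\<lambda>x. norm (G x) powr p) * ?IH"
    by (rule integral_mult_dilate_tendsto)
      (use p in \<open>auto intro!: continuous_intros cont simp: majorant_pair_periodic[OF hH]\<close>)
  moreover have "integral {0..1} (\<lambda>x. norm (G x) powr p) * ?IH < X ^ Suc n"
  proof -
    have "integral {0..1} (\<lambda>x. norm (G x) powr p) * ?IH \<le> X ^ n * ?IH"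
      by (intro mult_right_mono IG integral_norm_powr_nonneg)
    also have "\<dots> < X ^ n * X" using X X0 by simp
    finally show ?thesis by (simp add: mult.commute)
  qed
  ultimately have ev1: "\<forall>\<^sub>F L in sequentially.
      integral {0..1} (\<lambda>x. norm (G x) powr p * norm (H (real L * x)) powr p) < X ^ Suc n"
    by (rule order_tendstoD(2))
  have "(\<lambda>L. integral {a..b} (\<lambda>x. norm (g x) powr q * norm (h (real L * x)) powr q))
      \<longlonglongrightarrow> integral {a..b} (\<lambda>x. norm (g x) powr q) * ?Ih"
    by (rule integral_mult_dilate_tendsto)
      (use q ab in \<open>auto intro!: continuous_intros cont simp: majorant_pair_periodic[OF hH]\<close>)
  moreover have "(b - a) * Y ^ Suc n < integral {a..b} (\<lambda>x. norm (g x) powr q) * ?Ih"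
  proof -
    have "(b - a) * Y ^ Suc n = (b - a) * Y ^ n * Y" by simp
    also have "\<dots> < (b - a) * Y ^ n * ?Ih"
      using Y ab by (intro mult_strict_left_mono) auto
    also have "\<dots> \<le> integral {a..b} (\<lambda>x. norm (g x) powr q) * ?Ih"
      by (intro mult_right_mono Ig integral_norm_powr_nonneg)
    finally show ?thesis .
  qed
  ultimately have ev2: "\<forall>\<^sub>F L in sequentially. (b - a) * Y ^ Suc n
      < integral {a..b} (\<lambda>x. norm (g x) powr q * norm (h (real L * x)) powr q)"
    by (rule order_tendstoD(1))
  \<comment> \<open>One dilation factor has to serve both limits, since \<open>g\<close> and
    \<open>G\<close> must be multiplied by the same dilate of the pair.\<close>
  obtain L where L1: "integral {0..1} (\<lambda>x. norm (G x) powr p * norm (H (real L * x)) powr p) < X ^ Suc n"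
    and L2: "(b - a) * Y ^ Suc n < integral {a..b} (\<lambda>x. norm (g x) powr q * norm (h (real L * x)) powr q)"
    using eventually_happens[OF eventually_conj[OF ev1 ev2]] by auto
  have "majorant_pair (\<lambda>x. g x * h (real L * x)) (\<lambda>x. G x * H (real L * x))"
    by (intro majorant_pair_mult gG majorant_pair_dilate hH)
  moreover have "norm (g x * h (real L * x)) \<le> B ^ Suc n" for x
    unfolding norm_mult power_Suc2 by (intro mult_mono gB B) (use B0 in auto)
  ultimately show ?case
    using L1 L2 by (intro exI[of _ "\<lambda>x. g x * h (real L * x)"] exI[of _ "\<lambda>x. G x * H (real L * x)"])
      (simp add: norm_mult powr_mult del: power_Suc)
qed

subsection \<open>Localisation\<close>

lemma powr_add_le:
  fixes a b p :: real
  assumes "a \<ge> 0" "b \<ge> 0" "p > 0"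
  shows "(a + b) powr p \<le> 2 powr p * (a powr p + b powr p)"
proof -
  have "(a + b) powr p \<le> (2 * max a b) powr p"
    using assms by (intro powr_mono2) auto
  also have "\<dots> = 2 powr p * max a b powr p"
    using assms by (simp add: powr_mult)
  also have "max a b powr p \<le> a powr p + b powr p"
    by (simp add: max_def)
  finally show ?thesis by simp
qed

text \<open>Bridge from the Lebesgue integral in \<open>torus_int\<close> to the gauge integral used
  in all estimates.\<close>

lemma torus_int_UNIV:
  assumes "continuous_on {0..1} f" "p > 0"
  shows "torus_int UNIV f p = integral {0..1} (\<lambda>x. norm (f x) powr p)"
  unfolding torus_int_def Int_UNIV_left
  by (intro set_borel_integral_eq_integral borel_integrable_atLeastAtMost' continuous_intros assms)

text \<open>Nonnegativity of \<open>u\<close> allows enlarging the domain from the complement of E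
  to the whole interval, where the two integrals agree.\<close>

lemma torus_int_le:
  fixes u :: "real \<Rightarrow> real"
  assumes f: "continuous_on {0..1} f" "p > 0" and E: "open E" and u: "continuous_on {0..1} u"
    and u0: "\<And>x. x \<in> {0..1} \<Longrightarrow> u x \<ge> 0"
    and le: "\<And>x. x \<in> {0..1} \<Longrightarrow> x \<notin> E \<Longrightarrow> norm (f x) powr p \<le> u x"
  shows "torus_int (UNIV - E) f p \<le> integral {0..1} u"
proof -
  have iu: "set_integrable lborel {0..1} u"
    by (intro borel_integrable_atLeastAtMost' u)
  have "set_integrable lborel {0..1} (\<lambda>x. norm (f x) powr p)"
    by (intro borel_integrable_atLeastAtMost' continuous_intros f)
  then have if': "set_integrable lborel ((UNIV - E) \<inter> {0..1}) (\<lambda>x. norm (f x) powr p)"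
    by (rule set_integrable_subset) (use E in auto)
  have "torus_int (UNIV - E) f p \<le> (LINT x:{0..1}|lborel. u x)"
    unfolding torus_int_def set_lebesgue_integral_def
    using if' iu unfolding set_integrable_def
    by (rule integral_mono) (use u0 le in \<open>auto simp: indicator_def\<close>)
  also have "\<dots> = integral {0..1} u"
    using iu by (rule set_borel_integral_eq_integral)
  finally show ?thesis .
qed

text \<open>Monotonicity of norms on a probability space, up to the factor 2: apply
  \<open>powr_le_affine\<close> with exponent q/p to |G|^p / V and integrate.\<close>

lemma integral_powr_le_lower_exponent:
  fixes G :: "real \<Rightarrow> complex" and p q V :: real
  assumes pq: "0 < q" "q \<le> p" and V: "V > 0" and G: "continuous_on {0..1} G"
    and le: "integral {0..1} (\<lambda>x. norm (G x) powr p) \<le> V"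
  shows "integral {0..1} (\<lambda>x. norm (G x) powr q) \<le> 2 * V powr (q / p)"
proof -
  have pt: "norm (G x) powr q \<le> V powr (q / p) * (1 + norm (G x) powr p / V)" for x
  proof -
    define t where "t = norm (G x) powr p / V"
    have t: "t \<ge> 0" using V by (simp add: t_def)
    have "norm (G x) powr q = (V * t) powr (q / p)"
      using V pq by (simp add: t_def powr_powr)
    also have "\<dots> = V powr (q / p) * t powr (q / p)"
      using V t by (simp add: powr_mult)
    also have "\<dots> \<le> V powr (q / p) * (1 + t)"
    proof (intro mult_left_mono)
      have "t powr (q / p) \<le> 1 + q / p * (t - 1)"
        using pq t by (intro powr_le_affine) auto
      also have "q / p * (t - 1) \<le> t"
      proof -
        have "q / p * (t - 1) \<le> q / p * t" using pq by (intro mult_left_mono) auto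
        also have "\<dots> \<le> 1 * t" using pq t by (intro mult_right_mono) auto
        finally show ?thesis by simp
      qed
      finally show "t powr (q / p) \<le> 1 + t" by simp
    qed simp
    finally show ?thesis by (simp add: t_def)
  qed
  have "integral {0..1} (\<lambda>x. norm (G x) powr q) \<le>
      integral {0..1} (\<lambda>x. V powr (q / p) * (1 + norm (G x) powr p / V))"
    using pq V pt by (intro integral_le integrable_continuous_interval continuous_intros G) auto
  also have "\<dots> = V powr (q / p) * (1 + integral {0..1} (\<lambda>x. norm (G x) powr p) / V)"
  proof -
    have "integral {0..1} (\<lambda>x. 1 + norm (G x) powr p / V) = 1 + integral {0..1} (\<lambda>x. norm (G x) powr p) / V"
      using pq V by (subst integral_add) (auto intro!: integrable_continuous_interval continuous_intros G)
    then show ?thesis by simp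
  qed
  also have "\<dots> \<le> V powr (q / p) * (1 + 1)"
    using V le by (intro mult_left_mono add_left_mono) auto
  finally show ?thesis by simp
qed

text \<open>This is the squared cosine of pi x, the kernel \<kappa>, written so that its
  coefficients 1/4, 1/2, 1/4 are visible.\<close>

definition bump :: "real \<Rightarrow> real" where
  "bump x = (1 + cos (2 * pi * x)) / 2"

lemma bump_nonneg: "bump x \<ge> 0"
  using cos_double_cos[of "pi * x"] by (simp add: bump_def mult.assoc)

lemma bump_le_1: "bump x \<le> 1"
  by (simp add: bump_def)

lemma continuous_on_bump [continuous_intros]:
  fixes f :: "real \<Rightarrow> real"
  shows "continuous_on S f \<Longrightarrow> continuous_on S (\<lambda>x. bump (f x))"
  unfolding bump_def by (intro continuous_intros) auto

lemma bump_eq_1D: "bump x = 1 \<Longrightarrow> \<exists>n::int. x = of_int n"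
  unfolding bump_def using cos_one_2pi_int[of "2 * pi * x"] by auto

lemma pos_def_trig_poly_bump: "pos_def_trig_poly (\<lambda>x. complex_of_real (bump x))"
proof -
  have "complex_of_real (bump x) = complex_of_real (1/2) + complex_of_real (1/4) * e 1 x + complex_of_real (1/4) * e (-1) x" for x
    by (simp add: bump_def e_eq_cis complex_eq_iff)
  moreover have "pos_def_trig_poly (\<lambda>x. complex_of_real (1/2) + complex_of_real (1/4) * e 1 x + complex_of_real (1/4) * e (-1) x)"
    by (intro pos_def_trig_poly_add pos_def_trig_poly_const pos_def_trig_poly_monomial) auto
  ultimately show ?thesis by simp
qed

text \<open>A translate reaches 1 only at points congruent to \<open>y\<close> or
  \<open>- y\<close>, which lie in E by periodicity and symmetry. Off E the maximum of the two
  translates is attained on a compact set, hence stays below 1.\<close>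

lemma bump_translates_less_1:
  assumes E: "torus_set E" "open E" "zero_symmetric E" and y: "y \<in> E"
  obtains \<gamma> where "0 \<le> \<gamma>" "\<gamma> < 1"
    "\<And>x. x \<in> {0..1} \<Longrightarrow> x \<notin> E \<Longrightarrow> bump (x - y) \<le> \<gamma> \<and> bump (x + y) \<le> \<gamma>"
proof -
  define S where "S = {0..1} - E"
  have per: "z + of_int k \<in> E \<longleftrightarrow> z \<in> E" for z k
    using periodic_of_int[of "\<lambda>x. x \<in> E" z k] E(1) unfolding torus_set_def by blast
  have less: "bump (x - y) < 1 \<and> bump (x + y) < 1" if "x \<notin> E" for x
  proof (intro conjI)
    have "bump (x - y) \<noteq> 1"
    proof
      assume "bump (x - y) = 1"
      then obtain n :: int where "x = y + of_int n" using bump_eq_1D[of "x - y"] by (auto simp: algebra_simps)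
      then show False using that per y by auto
    qed
    then show "bump (x - y) < 1" using bump_le_1[of "x - y"] by simp
    have "bump (x + y) \<noteq> 1"
    proof
      assume "bump (x + y) = 1"
      then obtain n :: int where "x = - y + of_int n" using bump_eq_1D[of "x + y"] by (auto simp: algebra_simps)
      moreover have "- y \<in> E" using E(3) y unfolding zero_symmetric_def by blast
      ultimately show False using that per[of "- y" n] by simp
    qed
    then show "bump (x + y) < 1" using bump_le_1[of "x + y"] by simp
  qed
  have S: "compact S" unfolding S_def using E(2) by (intro compact_diff) auto
  show ?thesis
  proof (cases "S = {}")
    case True
    then show ?thesis by (intro that[of 0]) (auto simp: S_def)
  next
    case False
    have "continuous_on S (\<lambda>x. max (bump (x - y)) (bump (x + y)))"
      by (intro continuous_intros)
    from continuous_attains_sup[OF S False this] obtain z where z: "z \<in> S"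
      "\<And>x. x \<in> S \<Longrightarrow> max (bump (x - y)) (bump (x + y)) \<le> max (bump (z - y)) (bump (z + y))"
      by blast
    show ?thesis
      by (rule that[of "max (bump (z - y)) (bump (z + y))"])
        (use z less[of z] bump_nonneg[of "z - y"] in \<open>auto simp: S_def le_max_iff_disj\<close>)
  qed
qed

subsection \<open>Concentration\<close>

text \<open>Turns one failure of the majorant property into concentration on every admissible E.
  Nontriviality of \<open>f\<close> is part of the claim because the zero polynomial satisfies the
  inequality for free.\<close>

lemma concentration:
  fixes p q \<epsilon> :: real
  assumes pq: "0 < q" "q \<le> p" and hH: "majorant_pair h H"
    and sep: "integral {0..1} (\<lambda>x. norm (H x) powr p) < integral {0..1} (\<lambda>x. norm (h x) powr q) powr (p / q)"
    and E: "torus_set E" "open E" "zero_symmetric E" "torus_measure E > 0" and \<epsilon>: "\<epsilon> > 0"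
  shows "\<exists>f. pos_def_trig_poly f \<and> f \<noteq> (\<lambda>x. 0) \<and>
    torus_int (UNIV - E) f p \<le> \<epsilon> * (torus_int UNIV f q) powr (p / q)"
proof -
  have p: "p > 0" using pq by simp
  let ?Ih = "integral {0..1} (\<lambda>x. norm (h x) powr q)"
  have Ih: "?Ih \<ge> 0" by (rule integral_norm_powr_nonneg)
  obtain X where X: "integral {0..1} (\<lambda>x. norm (H x) powr p) < X" "X < ?Ih powr (p / q)"
    using dense[OF sep] by blast
  have X0: "X > 0" using X integral_norm_powr_nonneg[of "{0..1}" H p] by linarith
  \<comment> \<open>Growth rate of the q-integral of \<open>G\<close> per tensor factor; the
    hypothesis \<open>sep\<close> puts it strictly below the rate of \<open>h\<close>.\<close>
  define W where "W = X powr (q / p)"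
  have W0: "W > 0" using X0 by (simp add: W_def)
  have "W < (?Ih powr (p / q)) powr (q / p)"
    unfolding W_def using X X0 pq by (intro powr_less_mono2) auto
  also have "\<dots> = ?Ih" using pq Ih by (simp add: powr_powr)
  finally obtain Y where Y: "W < Y" "Y < ?Ih" using dense by blast
  have Y0: "Y > 0" using Y W0 by linarith
  obtain B where B: "B > 0" "\<And>x. norm (h x) \<le> B"
    using periodic_continuous_bounded[of h] majorant_pair_continuous(1)[OF hH] majorant_pair_periodic(1)[OF hH]
    by metis
  have "E \<inter> {0..<1} \<noteq> {}"
    using E(4) unfolding torus_measure_def by (metis emeasure_empty less_irrefl)
  then obtain y where y: "y \<in> E" "0 \<le> y" "y < 1" by auto
  obtain \<gamma> where \<gamma>: "0 \<le> \<gamma>" "\<gamma> < 1"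
    "\<And>x. x \<in> {0..1} \<Longrightarrow> x \<notin> E \<Longrightarrow> bump (x - y) \<le> \<gamma> \<and> bump (x + y) \<le> \<gamma>"
    using bump_translates_less_1[OF E(1-3) y(1)] by blast
  \<comment> \<open>\<open>A\<close> is the number of bump factors per tensor factor: off E they
    must bring \<open>B\<close> down to X^(1/p).\<close>
  obtain A where "\<gamma> ^ A < X powr (1 / p) / B"
    using real_arch_pow_inv[of "X powr (1 / p) / B" \<gamma>] X0 B(1) \<gamma>(2) by auto
  then have A: "\<gamma> ^ A * B \<le> X powr (1 / p)"
    using B(1) by (simp add: field_simps)
  \<comment> \<open>\<theta> is chosen after \<open>A\<close>: near \<open>y\<close> the bump
    factors cost at most (\<theta>^A)^q per tensor factor, and the remaining rate \<open>Z\<close>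
    must still exceed \<open>W\<close>.\<close>
  have "((\<lambda>\<theta>. (\<theta> ^ A) powr q * Y) \<longlongrightarrow> (1 ^ A) powr q * Y) (at_left (1::real))"
    by (intro tendsto_intros) auto
  then have "\<forall>\<^sub>F \<theta> in at_left (1::real). W < (\<theta> ^ A) powr q * Y"
    using Y(1) by (intro order_tendstoD(1)) auto
  moreover have "\<forall>\<^sub>F \<theta> in at_left (1::real). \<theta> \<in> {0<..<1}"
    by (rule eventually_at_left_real) simp
  ultimately have "\<forall>\<^sub>F \<theta> in at_left (1::real). W < (\<theta> ^ A) powr q * Y \<and> \<theta> \<in> {0<..<1}"
    by (rule eventually_conj)
  then obtain \<theta> where \<theta>: "W < (\<theta> ^ A) powr q * Y" "0 < \<theta>" "\<theta> < 1"
    using eventually_happens[of _ "at_left (1::real)"] by (auto simp: trivial_limit_at_left_real)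
  define Z where "Z = (\<theta> ^ A) powr q * Y"
  have Z: "W < Z" using \<theta> by (simp add: Z_def)
  have "isCont bump 0" unfolding bump_def[abs_def] by (intro continuous_intros) auto
  then have "(bump \<longlongrightarrow> 1) (at 0)" by (simp add: isCont_def bump_def)
  then have "\<forall>\<^sub>F x in at 0. \<theta> < bump x" using \<theta>(3) by (rule order_tendstoD(1))
  then obtain d0 where d0: "d0 > 0" "\<And>x. x \<noteq> 0 \<Longrightarrow> dist x 0 < d0 \<Longrightarrow> \<theta> < bump x"
    by (auto simp: eventually_at)
  define d where "d = min (d0 / 2) (1 - y)"
  have d: "d > 0" "y + d \<le> 1" "d < d0" using d0(1) y by (auto simp: d_def)
  have bump_J: "\<theta> \<le> bump (x - y)" if "x \<in> {y..y + d}" for x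
  proof (cases "x = y")
    case True
    then show ?thesis using \<theta> by (simp add: bump_def)
  next
    case False
    then show ?thesis using d0(2)[of "x - y"] that d by (simp add: dist_real_def)
  qed
  \<comment> \<open>Solves \<epsilon> (M W^n)^(p/q) = 2 * 4^p X^n, the right side being the bound
    for the integral off E. It remains to show that the q-integral of \<open>f\<close> is at least M
    W^n.\<close>
  define M where "M = (2 * 4 powr p / \<epsilon>) powr (q / p)"
  have M0: "M > 0" using \<epsilon> by (simp add: M_def)
  have "1 < Z / W" using Z W0 by simp
  \<comment> \<open>Wait for the gain (Z/W)^n to cover both the target \<open>M\<close> and the
    contribution of \<open>F1\<close> to the lower estimate.\<close>
  then obtain n where "(2 powr q * M + 2 * 4 powr q) / d < (Z / W) ^ n"
    using real_arch_pow by blast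
  then have n: "2 powr q * M + 2 * 4 powr q \<le> d * (Z / W) ^ n"
    using d(1) by (simp add: field_simps)
  have yd: "y < y + d" using d(1) by simp
  obtain g G where gG: "majorant_pair g G" and gB: "\<And>x. norm (g x) \<le> B ^ n"
    and IG: "integral {0..1} (\<lambda>x. norm (G x) powr p) \<le> X ^ n"
    and Ig: "(y + d - y) * Y ^ n \<le> integral {y..y + d} (\<lambda>x. norm (g x) powr q)"
    using majorant_pair_tensor_power[OF p pq(1) yd hH B(2) X(1) Y0 Y(2), of n] by blast
  define N where "N = A * n"
  define b where "b = (\<lambda>x. bump (x - y) ^ N + bump (x + y) ^ N)"
  define F1 where "F1 = (\<lambda>x. 2 * complex_of_real (bump x) ^ N * G x)"
  define F2 where "F2 = (\<lambda>x. complex_of_real (b x) * g x)"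
  define f where "f = (\<lambda>x. F1 x + F2 x)"
  have maj: "majorant_pair F2 F1"
    using majorant_pair_mult[OF majorant_pair_symmetric_translates[OF
          pos_def_trig_poly_power[OF pos_def_trig_poly_bump, of N], of y] gG]
    by (simp add: F1_def F2_def b_def)
  then have f: "pos_def_trig_poly f"
    unfolding majorant_pair_def f_def by blast
  note contf = pos_def_trig_poly_continuous[OF f]
  note contG = majorant_pair_continuous(2)[OF gG] and contg = majorant_pair_continuous(1)[OF gG]
  have F1: "norm (F1 x) \<le> 2 * norm (G x)" for x
  proof -
    have "bump x ^ N \<le> 1" using bump_nonneg bump_le_1 by (intro power_le_one) auto
    then have "bump x ^ N * norm (G x) \<le> 1 * norm (G x)" by (intro mult_right_mono) auto
    then show ?thesis using bump_nonneg[of x] by (simp add: F1_def norm_mult norm_power)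
  qed
  have b0: "b x \<ge> 0" for x using bump_nonneg by (simp add: b_def)
  have F2: "norm (F2 x) = b x * norm (g x)" for x
    using b0[of x] by (simp add: F2_def norm_mult)
  \<comment> \<open>Here \<open>F1\<close> is at most twice |G|, and \<open>F2\<close> is at most
    twice X^(n/p) by the choice of \<open>A\<close>.\<close>
  have off: "norm (f x) powr p \<le> 4 powr p * (norm (G x) powr p + X ^ n)" if x: "x \<in> {0..1}" "x \<notin> E" for x
  proof -
    have "b x \<le> \<gamma> ^ N + \<gamma> ^ N"
      unfolding b_def using \<gamma>(3)[OF x] bump_nonneg by (intro add_mono power_mono) auto
    then have "norm (F2 x) \<le> (2 * \<gamma> ^ N) * B ^ n"
      unfolding F2 using \<gamma>(1) by (intro mult_mono gB) auto
    also have "\<dots> = 2 * (\<gamma> ^ A * B) ^ n"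
      by (simp add: N_def power_mult power_mult_distrib)
    also have "\<dots> \<le> 2 * (X powr (1 / p)) ^ n"
      using A \<gamma>(1) B(1) by (intro mult_left_mono power_mono) auto
    finally have "norm (f x) \<le> 2 * norm (G x) + 2 * (X powr (1 / p)) ^ n"
      unfolding f_def using F1[of x] norm_triangle_ineq[of "F1 x" "F2 x"] by linarith
    then have "norm (f x) powr p \<le> (2 * norm (G x) + 2 * (X powr (1 / p)) ^ n) powr p"
      using p by (intro powr_mono2) auto
    also have "\<dots> \<le> 2 powr p * ((2 * norm (G x)) powr p + (2 * (X powr (1 / p)) ^ n) powr p)"
      using p by (intro powr_add_le) auto
    also have "\<dots> = (2 powr p * 2 powr p) * (norm (G x) powr p + ((X powr (1 / p)) ^ n) powr p)"
      by (simp add: powr_mult algebra_simps)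
    also have "2 powr p * 2 powr p = 4 powr p"
      by (simp flip: powr_mult)
    also have "((X powr (1 / p)) ^ n) powr p = X ^ n"
      using X0 p by (simp add: powr_powr flip: powr_realpow)
    finally show ?thesis .
  qed
  have "torus_int (UNIV - E) f p \<le> integral {0..1} (\<lambda>x. 4 powr p * (norm (G x) powr p + X ^ n))"
    using off X0 p by (intro torus_int_le contf E continuous_intros contG) auto
  also have "\<dots> = 4 powr p * (integral {0..1} (\<lambda>x. norm (G x) powr p) + X ^ n)"
  proof -
    have "integral {0..1} (\<lambda>x. norm (G x) powr p + X ^ n) = integral {0..1} (\<lambda>x. norm (G x) powr p) + X ^ n"
      using p by (subst integral_add) (auto intro!: integrable_continuous_interval continuous_intros contG)
    then show ?thesis by simp
  qed
  also have "\<dots> \<le> 4 powr p * (X ^ n + X ^ n)"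
    using IG by (intro mult_left_mono add_right_mono) auto
  finally have upper: "torus_int (UNIV - E) f p \<le> 2 * 4 powr p * X ^ n" by simp
  define I where "I = integral {0..1} (\<lambda>x. norm (f x) powr q)"
  have Wn: "(X ^ n) powr (q / p) = W ^ n"
    using X0 by (simp add: W_def powr_powr mult_ac flip: powr_realpow)
  have IGq: "integral {0..1} (\<lambda>x. norm (G x) powr q) \<le> 2 * W ^ n"
    using integral_powr_le_lower_exponent[OF pq _ contG IG] X0 by (simp add: Wn)
  \<comment> \<open>Near \<open>y\<close> the large summand is recovered as F2 = f - F1, with |F1|
    at most 2|G|.\<close>
  have onJ: "(\<theta> ^ N) powr q * norm (g x) powr q \<le> 2 powr q * norm (f x) powr q + 4 powr q * norm (G x) powr q"
    if x: "x \<in> {y..y + d}" for x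
  proof -
    have "\<theta> ^ N \<le> b x"
      using power_mono[OF bump_J[OF x], of N] \<theta> bump_nonneg[of "x + y"] by (simp add: b_def add_increasing2)
    then have "\<theta> ^ N * norm (g x) \<le> norm (F2 x)"
      unfolding F2 by (intro mult_right_mono) auto
    also have "\<dots> \<le> norm (f x) + norm (F1 x)"
      using norm_triangle_ineq4[of "f x" "F1 x"] by (simp add: f_def)
    also have "\<dots> \<le> norm (f x) + 2 * norm (G x)" using F1 by simp
    finally have "(\<theta> ^ N * norm (g x)) powr q \<le> (norm (f x) + 2 * norm (G x)) powr q"
      using pq \<theta> by (intro powr_mono2) auto
    also have "\<dots> \<le> 2 powr q * (norm (f x) powr q + (2 * norm (G x)) powr q)"
      using pq by (intro powr_add_le) auto
    also have "\<dots> = 2 powr q * norm (f x) powr q + (2 powr q * 2 powr q) * norm (G x) powr q"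
      by (simp add: powr_mult algebra_simps)
    also have "2 powr q * 2 powr q = 4 powr q"
      by (simp flip: powr_mult)
    finally show ?thesis using \<theta> by (simp add: powr_mult)
  qed
  \<comment> \<open>The lower bound for \<open>g\<close> is local, whereas the bounds for
    \<open>f\<close> and \<open>G\<close> are over a full period.\<close>
  have sub: "integral {y..y + d} (\<lambda>x. norm (k x) powr q) \<le> integral {0..1} (\<lambda>x. norm (k x) powr q)"
    if "continuous_on UNIV k" for k :: "real \<Rightarrow> complex"
    using y d pq continuous_on_subset[OF that]
    by (intro integral_subset_le integrable_continuous_interval continuous_intros) auto
  have "d * Z ^ n = (\<theta> ^ N) powr q * (d * Y ^ n)"
    using \<theta>(2) Y0 by (simp add: Z_def N_def power_mult power_mult_distrib powr_powr mult_ac flip: powr_realpow powr_mult)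
  also have "\<dots> \<le> (\<theta> ^ N) powr q * integral {y..y + d} (\<lambda>x. norm (g x) powr q)"
    using Ig by (intro mult_left_mono) auto
  also have "\<dots> = integral {y..y + d} (\<lambda>x. (\<theta> ^ N) powr q * norm (g x) powr q)" by simp
  also have "\<dots> \<le> integral {y..y + d} (\<lambda>x. 2 powr q * norm (f x) powr q + 4 powr q * norm (G x) powr q)"
    using onJ pq by (intro integral_le integrable_continuous_interval continuous_intros contf contG contg) auto
  also have "\<dots> = 2 powr q * integral {y..y + d} (\<lambda>x. norm (f x) powr q)
      + 4 powr q * integral {y..y + d} (\<lambda>x. norm (G x) powr q)"
    using pq by (subst integral_add) (auto intro!: integrable_continuous_interval continuous_intros contf contG)
  also have "\<dots> \<le> 2 powr q * I + 4 powr q * (2 * W ^ n)"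
    unfolding I_def using sub[OF contf] order_trans[OF sub[OF contG] IGq]
    by (intro add_mono mult_left_mono) auto
  finally have "d * Z ^ n \<le> 2 powr q * I + 2 * 4 powr q * W ^ n" by simp
  moreover have "d * Z ^ n = d * (Z / W) ^ n * W ^ n"
    using W0 by (simp add: power_divide)
  moreover have "(2 powr q * M + 2 * 4 powr q) * W ^ n \<le> d * (Z / W) ^ n * W ^ n"
    using n W0 by (intro mult_right_mono) auto
  then have "2 powr q * (M * W ^ n) + 2 * 4 powr q * W ^ n \<le> d * (Z / W) ^ n * W ^ n"
    by (simp only: distrib_right mult.assoc)
  ultimately have "2 powr q * (M * W ^ n) \<le> 2 powr q * I"
    by linarith
  then have lower: "M * W ^ n \<le> I" by simp
  have I0: "I > 0" using lower M0 W0 by (meson less_le_trans mult_pos_pos zero_less_power)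
  have tI: "torus_int UNIV f q = I"
    unfolding I_def using contf pq(1) by (rule torus_int_UNIV)
  have "2 * 4 powr p * X ^ n = \<epsilon> * (M * W ^ n) powr (p / q)"
  proof -
    have "M powr (p / q) = 2 * 4 powr p / \<epsilon>"
      using \<epsilon> pq by (simp add: M_def powr_powr)
    moreover have "(W ^ n) powr (p / q) = X ^ n"
      using X0 pq by (simp add: powr_powr flip: Wn)
    ultimately show ?thesis
      using \<epsilon> M0 W0 by (simp add: powr_mult)
  qed
  also have "\<dots> \<le> \<epsilon> * I powr (p / q)"
    using lower M0 W0 pq \<epsilon> by (intro mult_left_mono powr_mono2) auto
  finally have "2 * 4 powr p * X ^ n \<le> \<epsilon> * I powr (p / q)" .
  with upper have "torus_int (UNIV - E) f p \<le> \<epsilon> * (torus_int UNIV f q) powr (p / q)"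
    unfolding tI by linarith
  moreover have "f \<noteq> (\<lambda>x. 0)"
    using I0 by (auto simp: I_def)
  ultimately show ?thesis using f by blast
qed

theorem theorem3:
  shows "(\<forall>p q E (\<epsilon>::real). 0 < q \<and> q \<le> p \<and> p < 2 \<and>
            torus_set E \<and> open E \<and> zero_symmetric E \<and> torus_measure E > 0 \<and> \<epsilon> > 0 \<longrightarrow>
            (\<exists>f. pos_def_trig_poly f \<and> f \<noteq> (\<lambda>x. 0) \<and>
                 torus_int (UNIV - E) f p \<le> \<epsilon> * (torus_int UNIV f q) powr (p / q)))
       \<and>
         (\<forall>p::real. p > 0 \<and> (\<forall>n::nat. p \<noteq> 2 * real n) \<longrightarrow>
            (\<exists>qp < p. \<forall>q E (\<epsilon>::real). qp < q \<and> q < p \<and> 0 < q \<and>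
               torus_set E \<and> open E \<and> zero_symmetric E \<and> torus_measure E > 0 \<and> \<epsilon> > 0 \<longrightarrow>
               (\<exists>f. pos_def_trig_poly f \<and> f \<noteq> (\<lambda>x. 0) \<and>
                    torus_int (UNIV - E) f p \<le> \<epsilon> * (torus_int UNIV f q) powr (p / q))))"
proof (intro conjI allI impI)
  fix p q :: real and E \<epsilon>
  assume *: "0 < q \<and> q \<le> p \<and> p < 2 \<and>
    torus_set E \<and> open E \<and> zero_symmetric E \<and> torus_measure E > 0 \<and> (\<epsilon>::real) > 0"
  then obtain h H where "majorant_pair h H"
    "integral {0..1} (\<lambda>x. norm (H x) powr p) < integral {0..1} (\<lambda>x. norm (h x) powr q) powr (p / q)"
    using majorant_failure_below_two by blast
  with * show "\<exists>f. pos_def_trig_poly f \<and> f \<noteq> (\<lambda>x. 0) \<and>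
      torus_int (UNIV - E) f p \<le> \<epsilon> * (torus_int UNIV f q) powr (p / q)"
    by (intro concentration) auto
next
  fix p :: real
  assume p: "p > 0 \<and> (\<forall>n::nat. p \<noteq> 2 * real n)"
  then obtain h H where hH: "majorant_pair h H"
    "integral {0..1} (\<lambda>x. norm (H x) powr p) < integral {0..1} (\<lambda>x. norm (h x) powr p)"
    using majorant_failure by blast
  \<comment> \<open>The pair depends on p alone, so \<open>q0\<close> is fixed before q, E and
    \<epsilon>. Nothing forces it to be nonnegative, hence the separate condition 0 < q.\<close>
  obtain q0 where q0: "q0 < p"
    "\<And>q. q0 < q \<Longrightarrow> q < p \<Longrightarrow> 0 < q \<Longrightarrow>
      integral {0..1} (\<lambda>x. norm (H x) powr p) < integral {0..1} (\<lambda>x. norm (h x) powr q) powr (p / q)"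
    using majorant_failure_left_neighbourhood[OF _ hH] p by blast
  show "\<exists>qp < p. \<forall>q E (\<epsilon>::real). qp < q \<and> q < p \<and> 0 < q \<and>
      torus_set E \<and> open E \<and> zero_symmetric E \<and> torus_measure E > 0 \<and> \<epsilon> > 0 \<longrightarrow>
      (\<exists>f. pos_def_trig_poly f \<and> f \<noteq> (\<lambda>x. 0) \<and>
        torus_int (UNIV - E) f p \<le> \<epsilon> * (torus_int UNIV f q) powr (p / q))"
  proof (intro exI[of _ q0] conjI allI impI q0(1))
    fix q E and \<epsilon> :: real
    assume "q0 < q \<and> q < p \<and> 0 < q \<and>
      torus_set E \<and> open E \<and> zero_symmetric E \<and> torus_measure E > 0 \<and> \<epsilon> > 0"
    then show "\<exists>f. pos_def_trig_poly f \<and> f \<noteq> (\<lambda>x. 0) \<and>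
        torus_int (UNIV - E) f p \<le> \<epsilon> * (torus_int UNIV f q) powr (p / q)"
      using hH(1) q0(2) by (intro concentration) auto
  qed
qed

end
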